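(* Let $q$ be a positive integer and let $\chi \pmod{q}$ be a primitive Dirichlet character. Put $$S_{\chi}=\max_{0\le M<N\le q}\left|\sum_{n=M}^{N}\chi(n)\right|,$$ where the maximum is over integers $M,N$. Let $\gamma$ be the Euler constant, $C_0=4\pi^{5/2}+5$, and $$\psi_1(q)=1+\frac{24}{\pi^2C_0}+\frac{8}{\pi^2}\frac{\sqrt{q}}{\exp\left(\frac{2\sqrt{q}}{C_0}\right)-1},\qquad \psi_2(q)=1+\frac{3}{C_0}+\frac{2}{\pi}\frac{\sqrt{q}}{\exp\left(\frac{\pi\sqrt{q}}{C_0}\right)-1}.$$ Then: (1) if $\chi(-1)=1$, then $$S_{\chi}\le\frac{2}{\pi^2}\sqrt{q}\log q+\frac{4}{\pi^2}\sqrt{q}\left(1+\gamma+\log C_0\right)+\psi_1(q);$$ (2) if $\chi(-1)=-1$, then $$S_{\chi}\le\frac{1}{2\pi}\sqrt{q}\log q+\frac{1}{\pi}\sqrt{q}\left(1+\gamma+\log\frac{2C_0}{\pi}\right)+\psi_2(q).$$ *)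

theory Defs
  imports "HOL-Analysis.Analysis" "HOL-Number_Theory.Number_Theory"
begin

text \<open>
  A Dirichlet character modulo \<open>q\<close> is regarded as a function on all integers, extended by zero to
  the integers that are not coprime to \<open>q\<close>. The equation \<open>chi 1 = 1\<close> follows from
  multiplicativity and \<open>chi 1 \<noteq> 0\<close>.
\<close>

definition dirichlet_character :: "nat \<Rightarrow> (int \<Rightarrow> complex) \<Rightarrow> bool" where
  "dirichlet_character q chi \<longleftrightarrow>
     q > 0 \<and>
     (\<forall>m n. chi (m * n) = chi m * chi n) \<and>
     (\<forall>n. chi (n + int q) = chi n) \<and>
     (\<forall>n. chi n \<noteq> 0 \<longleftrightarrow> coprime n (int q))"

text \<open>
  A divisor \<open>d\<close> of \<open>q\<close> is an induced modulus of \<open>chi\<close> if \<open>chi\<close> is trivial on the units modulo \<open>q\<close>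
  that are congruent to \<open>1\<close> modulo \<open>d\<close>, and \<open>chi\<close> is primitive if it has no induced modulus
  smaller than \<open>q\<close> (Apostol, Introduction to Analytic Number Theory, Chapter 8). In particular
  the constant function \<open>1\<close> is a primitive character modulo \<open>1\<close>.
\<close>

definition induced_modulus :: "nat \<Rightarrow> (int \<Rightarrow> complex) \<Rightarrow> nat \<Rightarrow> bool" where
  "induced_modulus q chi d \<longleftrightarrow>
     d dvd q \<and> (\<forall>a. coprime a (int q) \<and> [a = 1] (mod (int d)) \<longrightarrow> chi a = 1)"

definition primitive_dirichlet_character :: "nat \<Rightarrow> (int \<Rightarrow> complex) \<Rightarrow> bool" where
  "primitive_dirichlet_character q chi \<longleftrightarrow>
     dirichlet_character q chi \<and> \<not> (\<exists>d<q. induced_modulus q chi d)"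

definition max_char_sum :: "nat \<Rightarrow> (int \<Rightarrow> complex) \<Rightarrow> real" where
  "max_char_sum q chi =
     Max {norm (\<Sum>n=M..N. chi n) | M N :: int. 0 \<le> M \<and> M < N \<and> N \<le> int q}"

definition C\<^sub>0 :: real where
  "C\<^sub>0 = 4 * pi powr (5 / 2) + 5"

definition \<psi>\<^sub>1 :: "nat \<Rightarrow> real" where
  "\<psi>\<^sub>1 q = 1 + 24 / (pi\<^sup>2 * C\<^sub>0)
     + 8 / pi\<^sup>2 * (sqrt (real q) / (exp (2 * sqrt (real q) / C\<^sub>0) - 1))"

definition \<psi>\<^sub>2 :: "nat \<Rightarrow> real" where
  "\<psi>\<^sub>2 q = 1 + 3 / C\<^sub>0
     + 2 / pi * (sqrt (real q) / (exp (pi * sqrt (real q) / C\<^sub>0) - 1))"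

end

theory Submission
  imports Defs
begin

text \<open>
  By the Gauss sum identity, a primitive character is a combination of the additive characters
  \<open>n \<mapsto> e(a n / q)\<close> with coefficients of modulus at most \<open>1 / \<surd>q\<close>. Summing over an interval produces
  the weights \<open>1 / sin (\<pi> a / q)\<close>. Averaging the interval over about \<open>\<surd>q\<close> translates changes the
  character sum by at most about \<open>\<surd>q / 2\<close> and inserts a second factor \<open>1 / sin (\<pi> a / q)\<close>, so that
  frequencies beyond \<open>L \<approx> \<surd>q\<close> also contribute only about \<open>\<surd>q / 2\<close>. This cutoff turns \<open>log q\<close> into
  \<open>(log q) / 2\<close>. The low frequencies are governed by \<open>\<Sum>a\<le>L. \<bar>sin (a \<theta>)\<bar> / a\<close> for even characters and by
  \<open>\<Sum>a\<le>L. \<bar>sin (a \<theta>) sin (a \<phi>)\<bar> / a\<close> for odd ones. Both have the sharp leading constants, namely the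
  means \<open>2 / \<pi>\<close> and \<open>1 / 2\<close>, because \<open>\<Sum>a\<le>L. cos (a t) / a\<close> is bounded below uniformly in \<open>t\<close> and \<open>L\<close>.
\<close>

section \<open>Elementary inequalities\<close>

text \<open>This is the bound \<open>cos t >= 1 - t^2 / 2\<close> integrated from 0 to
  \<open>x\<close>, phrased as monotonicity of the difference.\<close>

lemma sin_ge_cubic:
  fixes x :: real
  assumes "0 \<le> x"
  shows "x - x ^ 3 / 6 \<le> sin x"
proof -
  have c: "1 - t\<^sup>2 / 2 \<le> cos t" for t :: real
  proof -
    have "cos t = 1 - 2 * (sin (t / 2))\<^sup>2"
      using cos_double_sin[of "t / 2"] by simp
    moreover have "(sin (t / 2))\<^sup>2 \<le> (t / 2)\<^sup>2"
      using abs_sin_x_le_abs_x[of "t / 2"] by (simp only: abs_le_square_iff)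
    ultimately show ?thesis by (simp add: power_divide)
  qed
  have "(\<lambda>t. sin t - (t - t ^ 3 / 6)) 0 \<le> (\<lambda>t. sin t - (t - t ^ 3 / 6)) x"
  proof (rule DERIV_nonneg_imp_nondecreasing[OF assms])
    fix t :: real
    have "((\<lambda>t. sin t - (t - t ^ 3 / 6)) has_real_derivative cos t - (1 - t\<^sup>2 / 2)) (at t)"
      by (auto intro!: derivative_eq_intros simp: power2_eq_square)
    with c[of t] show "\<exists>y. ((\<lambda>t. sin t - (t - t ^ 3 / 6)) has_real_derivative y) (at t) \<and> 0 \<le> y"
      by (intro exI[of _ "cos t - (1 - t\<^sup>2 / 2)"]) simp
  qed
  then show ?thesis by simp
qed

text \<open>Sine is concave on this interval, hence lies above the chord through its values at 0 and
  pi / 2.\<close>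

lemma Jordan_sin_ge:
  fixes x :: real
  assumes "0 \<le> x" "x \<le> pi / 2"
  shows "2 * x / pi \<le> sin x"
proof -
  have "concave_on {0..pi/2} sin"
  proof (rule f''_le0_imp_concave)
    show "(sin has_real_derivative cos x) (at x)" for x :: real
      by (rule DERIV_sin)
    show "(cos has_real_derivative - sin x) (at x)" for x :: real
      by (rule DERIV_cos)
    show "- sin x \<le> 0" if "x \<in> {0..pi/2}" for x :: real
      using that sin_ge_zero[of x] by simp
  qed simp
  from concave_onD[OF this, of "2 * x / pi" 0 "pi / 2"] assms show ?thesis
    by (simp add: field_simps)
qed

text \<open>The cubic lower bound for sine reduces the claim to (1 - y^2/6)(1 + y^2/3) >= 1. The
  left side equals 1 + y^2 (3 - y^2) / 18, so y^2 <= 3 suffices.\<close>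

lemma inverse_sin_le:
  fixes y :: real
  assumes "0 < y" "y \<le> pi / 2"
  shows "1 / sin y \<le> 1 / y + y / 3"
proof -
  have "y * y \<le> (16/10) * (16/10)"
    using assms pi_approx by (intro mult_mono) auto
  then have y2: "y\<^sup>2 \<le> 3" by (simp add: power2_eq_square)
  have "1 \<le> (1 - y\<^sup>2 / 6) * (1 + y\<^sup>2 / 3)"
  proof -
    have "0 \<le> y\<^sup>2 * (3 - y\<^sup>2)" using y2 by simp
    then show ?thesis by (simp add: algebra_simps)
  qed
  also have "\<dots> = (y - y ^ 3 / 6) * (1 / y + y / 3)"
    using assms by (simp add: field_simps power2_eq_square power3_eq_cube)
  also have "\<dots> \<le> sin y * (1 / y + y / 3)"
    using sin_ge_cubic[of y] assms by (intro mult_right_mono) auto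
  finally show ?thesis
    using assms sin_gt_zero[of y] pi_gt_zero by (simp add: divide_le_eq mult.commute)
qed

lemma cot_le_inverse:
  fixes y :: real
  assumes "0 < y" "y < pi / 2"
  shows "cot y \<le> 1 / y"
proof -
  have "0 < tan y" using assms by (rule tan_gt_zero)
  then have "arctan (tan y) \<le> tan y" by (intro arctan_le_self) simp
  then have "y \<le> tan y" using assms by (simp add: arctan_tan)
  then show ?thesis
    using assms by (simp add: cot_altdef field_simps)
qed

text \<open>The difference cot x - cot y equals sin (y - x) / (sin x sin y).\<close>

lemma cot_antimono:
  fixes x y :: real
  assumes "0 < x" "x \<le> y" "y < pi"
  shows "cot y \<le> cot x"
proof -
  have "0 \<le> sin (y - x)" using assms by (intro sin_ge_zero) auto
  moreover have "sin x > 0" "sin y > 0" using assms by (auto intro: sin_gt_zero)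
  ultimately show ?thesis by (simp add: cot_def sin_diff field_simps)
qed

lemma ln_add_le:
  fixes x c :: real
  assumes "0 < x" "0 \<le> c"
  shows "ln (x + c) \<le> ln x + c / x"
proof -
  have "x + c = x * (1 + c / x)" using assms by (simp add: field_simps)
  then have "ln (x + c) = ln (x * (1 + c / x))" by simp
  also have "\<dots> = ln x + ln (1 + c / x)" using assms by (intro ln_mult_pos) (auto intro: add_pos_nonneg)
  also have "ln (1 + c / x) \<le> c / x" using assms by (intro ln_add_one_self_le_self) simp
  finally show ?thesis by simp
qed

section \<open>Cosine sums\<close>

lemma harmonic_sum_le:
  assumes "0 < L"
  shows "(\<Sum>n=1..L. 1 / real n) \<le> ln (real L + 1) + euler_mascheroni"
proof -
  obtain k where k: "L = Suc k" using assms by (cases L) auto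
  have "(\<Sum>n=1..L. 1 / real n) = harm L" by (simp add: harm_def inverse_eq_divide)
  also have "\<dots> \<le> euler_mascheroni + ln (real (k + 2)) - 1 / real (2 * (k + 2))"
    using euler_mascheroni_lower[of k] k by simp
  also have "\<dots> \<le> ln (real L + 1) + euler_mascheroni" using k by simp
  finally show ?thesis .
qed

text \<open>Grouped in pairs, a sum of even length is minus a partial sum of a nonnegative series
  with total \<open>ln 2\<close>. An odd length adds the single term -1 / L.\<close>

lemma alternating_harmonic_ge:
  assumes "0 < L"
  shows "- ln 2 - 1 / real L \<le> (\<Sum>n=1..L. (-1) ^ n / real n)"
proof -
  have even: "- ln 2 \<le> (\<Sum>n=1..2*m. (-1) ^ n / real n)" for m
  proof -
    have eq: "(\<Sum>n=1..2*m. (-1) ^ n / real n)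
        = - (\<Sum>k<m. inverse (real_of_nat (2*k+1)) - inverse (real_of_nat (2*k+2)))" for m
      by (induction m) (simp_all add: inverse_eq_divide algebra_simps)
    have "(\<Sum>k<m. inverse (real_of_nat (2*k+1)) - inverse (real_of_nat (2*k+2))) \<le> ln 2"
      using alternating_harmonic_series_sums'
      by (subst sums_unique[of _ "ln 2"], assumption, intro sum_le_suminf)
         (auto simp: sums_iff field_simps)
    with eq show ?thesis by simp
  qed
  show ?thesis
  proof (cases "even L")
    case True
    then obtain m where m: "L = 2 * m" by blast
    have "0 \<le> 1 / real L" by simp
    with even[of m] show ?thesis unfolding m by linarith
  next
    case False
    then obtain m where m: "L = Suc (2 * m)" by (auto elim: oddE)
    with even[of m] show ?thesis by simp
  qed
qed

lemma sin_half_times_sum_sin: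
  fixes t :: real
  shows "2 * sin (t / 2) * (\<Sum>n=1..L. sin (real n * t)) = cos (t / 2) - cos ((real L + 1 / 2) * t)"
proof (induction L)
  case (Suc L)
  have "2 * sin (t / 2) * sin (real (Suc L) * t)
      = cos ((real L + 1 / 2) * t) - cos ((real (Suc L) + 1 / 2) * t)"
  proof -
    have "t / 2 - real (Suc L) * t = - ((real L + 1 / 2) * t)"
      and "t / 2 + real (Suc L) * t = (real (Suc L) + 1 / 2) * t"
      by (simp_all add: algebra_simps)
    then show ?thesis by (simp only: mult.assoc sin_times_sin cos_minus) simp
  qed
  with Suc show ?case by (simp add: algebra_simps)
qed (simp add: field_simps)

text \<open>For L tending to infinity the cosine sum tends to -ln 2 - ln (sin (t/2)). The finite
  version compares t with the endpoint pi, where the cosines become (-1)^n; the last term on the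
  left pays for the truncation.\<close>

lemma sum_cos_div_ge_endpoint:
  fixes t :: real and L :: nat
  assumes "0 < t" "t \<le> pi"
  defines "N \<equiv> real L + 1 / 2"
  shows "(\<Sum>n=1..L. (-1) ^ n / real n) - ln (sin (t / 2)) - 1 / (N * sin (t / 2))
           \<le> (\<Sum>n=1..L. cos (real n * t) / real n)"
proof -
  \<comment> \<open>The second and third terms almost cancel the derivative of the cosine sum, leaving a
    nonpositive remainder.\<close>
  define Q where "Q = (\<lambda>u. (\<Sum>n=1..L. cos (real n * u) / real n) + ln (sin (u / 2))
      + (1 - sin (N * u)) / (2 * N * sin (u / 2)))"
  have N: "0 < N" by (simp add: N_def)
  have "Q pi \<le> Q t"
  proof (rule DERIV_nonpos_imp_nonincreasing[OF assms(2)])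
    fix u assume "t \<le> u" "u \<le> pi"
    with assms have s: "sin (u / 2) > 0" by (intro sin_gt_zero) auto
    have c: "0 \<le> cos (u / 2)" using \<open>t \<le> u\<close> \<open>u \<le> pi\<close> assms by (intro cos_ge_zero) auto
    have sm: "(\<Sum>n=1..L. sin (real n * u)) = (cos (u / 2) - cos (N * u)) / (2 * sin (u / 2))"
      using sin_half_times_sum_sin[of u L] s by (simp add: N_def field_simps)
    have "((\<lambda>u. \<Sum>n=1..L. cos (real n * u) / real n) has_real_derivative
        (\<Sum>n=1..L. - sin (real n * u))) (at u)"
      by (rule DERIV_sum) (auto intro!: derivative_eq_intros)
    moreover have "((\<lambda>u. ln (sin (u / 2)) + (1 - sin (N * u)) / (2 * N * sin (u / 2)))
        has_real_derivative cos (u / 2) / (2 * sin (u / 2)) - cos (N * u) / (2 * sin (u / 2))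
          - (1 - sin (N * u)) * cos (u / 2) / (4 * N * (sin (u / 2))\<^sup>2)) (at u)"
      using s N by (auto intro!: derivative_eq_intros simp: field_simps power2_eq_square)
    ultimately have "(Q has_real_derivative (\<Sum>n=1..L. - sin (real n * u))
        + (cos (u / 2) / (2 * sin (u / 2)) - cos (N * u) / (2 * sin (u / 2))
          - (1 - sin (N * u)) * cos (u / 2) / (4 * N * (sin (u / 2))\<^sup>2))) (at u)"
      unfolding Q_def add.assoc by (rule DERIV_add)
    moreover have "(\<Sum>n=1..L. - sin (real n * u)) = - ((cos (u / 2) - cos (N * u)) / (2 * sin (u / 2)))"
      by (simp only: sum_negf sm)
    ultimately have "(Q has_real_derivative
          - ((1 - sin (N * u)) * cos (u / 2) / (4 * N * (sin (u / 2))\<^sup>2))) (at u)"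
      by (simp add: diff_divide_distrib)
    moreover have "0 \<le> (1 - sin (N * u)) * cos (u / 2) / (4 * N * (sin (u / 2))\<^sup>2)"
      using c N by (intro divide_nonneg_nonneg mult_nonneg_nonneg) auto
    ultimately show "\<exists>y. (Q has_real_derivative y) (at u) \<and> y \<le> 0"
      by (intro exI conjI) auto
  qed
  \<comment> \<open>At pi the logarithm vanishes and the quotient in \<open>Q\<close> is
    nonnegative.\<close>
  moreover have "(\<Sum>n=1..L. (-1) ^ n / real n) \<le> Q pi"
    using N by (simp add: Q_def)
  moreover have "(1 - sin (N * t)) / (2 * N * sin (t / 2)) \<le> 1 / (N * sin (t / 2))"
  proof -
    have "sin (t / 2) > 0" using assms by (intro sin_gt_zero) auto
    then have "(1 - sin (N * t)) / (2 * N * sin (t / 2)) \<le> 2 / (2 * N * sin (t / 2))"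
      using N sin_ge_minus_one[of "N * t"] by (intro divide_right_mono) auto
    then show ?thesis by simp
  qed
  ultimately show ?thesis unfolding Q_def by linarith
qed

text \<open>The error term of the endpoint comparison is harmless only for t >= pi / N. Below pi / N
  the sum is decreasing in t, so its value at t is at least its value at pi / N.\<close>

lemma sum_cos_div_ge_aux:
  fixes t :: real
  assumes "0 \<le> t" "t \<le> pi" "0 < L"
  shows "- ln 2 - 1 / real L - 1 / (real L + 1 / 2) \<le> (\<Sum>n=1..L. cos (real n * t) / real n)"
proof -
  define N where "N = real L + 1 / 2"
  have N: "1 < N" using assms by (simp add: N_def)
  have far: "- ln 2 - 1 / real L - 1 / N \<le> (\<Sum>n=1..L. cos (real n * t) / real n)"
    if t: "pi / N \<le> t" "t \<le> pi" for t
  proof -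
    define s where "s = sin (t / 2)"
    have tpos: "0 < t" using t N by (meson divide_pos_pos less_le_trans pi_gt_zero zero_less_one less_trans)
    have "1 / N = 2 * (pi / N / 2) / pi" by simp
    also have "\<dots> \<le> 2 * (t / 2) / pi"
      using t by (intro divide_right_mono mult_left_mono) auto
    also have "\<dots> \<le> s"
      unfolding s_def using t tpos by (intro Jordan_sin_ge) auto
    finally have s: "1 / N \<le> s" .
    have s0: "0 < s" using s N by (meson divide_pos_pos less_le_trans zero_less_one less_trans)
    have s1: "s \<le> 1" by (simp add: s_def)
    \<comment> \<open>Both factors are nonnegative because s lies in [1/N, 1]. Expanded, this says s
      + 1/(N s) <= 1 + 1/N, so the error term is absorbed by -ln s >= 1 - s at the cost of
      1/N.\<close>
    have "0 \<le> (1 - s) * (1 - 1 / (N * s))"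
      using s s0 s1 N by (intro mult_nonneg_nonneg) (auto simp: field_simps)
    also have "\<dots> = 1 - s - 1 / (N * s) + 1 / N"
      using s0 N by (simp add: field_simps)
    finally have "- 1 / N \<le> 1 - s - 1 / (N * s)" by simp
    also have "\<dots> \<le> - ln s - 1 / (N * s)" using ln_le_minus_one[OF s0] by simp
    finally show ?thesis
      using sum_cos_div_ge_endpoint[OF tpos t(2), of L] alternating_harmonic_ge[OF assms(3)]
      unfolding s_def N_def by simp
  qed
  show ?thesis
  proof (cases "pi / N \<le> t")
    case True
    with far[of t] assms show ?thesis by (simp add: N_def)
  next
    case False
    define T where "T = (\<lambda>u. \<Sum>n=1..L. cos (real n * u) / real n)"
    have "T (pi / N) \<le> T t"
    proof (rule DERIV_nonpos_imp_nonincreasing[of t "pi / N" T])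
      fix u assume u: "t \<le> u" "u \<le> pi / N"
      have "(T has_real_derivative (\<Sum>n=1..L. - sin (real n * u))) (at u)"
        unfolding T_def by (rule DERIV_sum) (auto intro!: derivative_eq_intros)
      moreover have "(\<Sum>n=1..L. - sin (real n * u)) \<le> 0"
      proof (rule sum_nonpos)
        fix n assume n: "n \<in> {1..L}"
        \<comment> \<open>All angles stay in [0, pi], so every sine in the derivative is
          nonnegative.\<close>
        have "real n * u \<le> N * (pi / N)"
          using n u assms N by (intro mult_mono) (auto simp: N_def)
        then show "- sin (real n * u) \<le> 0"
          using u assms N by (auto intro!: sin_ge_zero)
      qed
      ultimately show "\<exists>y. (T has_real_derivative y) (at u) \<and> y \<le> 0"
        by blast
    qed (use False in auto)
    moreover have "pi / N \<le> pi" using N by (simp add: field_simps)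
    ultimately show ?thesis using far[of "pi / N"] by (simp add: N_def T_def)
  qed
qed

text \<open>By the Chebyshev recurrence, cos (n x) is a polynomial in cos x.\<close>

lemma cos_multiple_cong:
  fixes x y :: real
  assumes "cos x = cos y"
  shows "cos (real n * x) = cos (real n * y)"
proof (induction n rule: induct_nat_012)
  case (ge2 n)
  have rec: "cos (real (Suc (Suc n)) * z) = 2 * cos z * cos (real (Suc n) * z) - cos (real n * z)"
    for z :: real
  proof -
    have "2 * cos z * cos (real (Suc n) * z) = cos (real n * z) + cos (real (Suc (Suc n)) * z)"
      by (subst mult.assoc, subst cos_times_cos, subst cos_minus[symmetric]) (simp add: algebra_simps)
    then show ?thesis by simp
  qed
  show ?case using ge2 assms by (simp only: rec)
qed (use assms in auto)

lemma sum_cos_div_ge: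
  fixes t :: real
  assumes "0 < L"
  shows "- ln 2 - 2 / real L \<le> (\<Sum>n=1..L. cos (real n * t) / real n)"
proof -
  \<comment> \<open>The angle is folded into [0, pi] without changing any cosine of its
    multiples.\<close>
  define u where "u = arccos (cos t)"
  have u: "0 \<le> u" "u \<le> pi" "cos t = cos u"
    by (simp_all add: u_def arccos_lbound arccos_ubound cos_arccos)
  have "1 / (real L + 1 / 2) \<le> 1 / real L" using assms by (intro divide_left_mono) auto
  moreover have "2 / real L = 1 / real L + 1 / real L" by simp
  ultimately have "- ln 2 - 2 / real L \<le> - ln 2 - 1 / real L - 1 / (real L + 1 / 2)" by linarith
  also have "\<dots> \<le> (\<Sum>n=1..L. cos (real n * u) / real n)"
    by (rule sum_cos_div_ge_aux[OF u(1,2) assms])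
  also have "\<dots> = (\<Sum>n=1..L. cos (real n * t) / real n)"
    using cos_multiple_cong[OF u(3)] by simp
  finally show ?thesis .
qed

section \<open>Finite Fourier analysis\<close>

lemma periodic_add_mult:
  fixes f :: "int \<Rightarrow> 'a"
  assumes "\<And>n. f (n + p) = f n"
  shows "f (n + p * k) = f n"
proof (induction k rule: int_induct[of _ 0])
  case (step1 i)
  then show ?case using assms[of "n + p * i"] by (simp add: algebra_simps)
next
  case (step2 i)
  then show ?case using assms[of "n + p * (i - 1)"] by (simp add: algebra_simps)
qed simp

lemma periodic_cong:
  fixes f :: "int \<Rightarrow> 'a"
  assumes "\<And>n. f (n + p) = f n" "[m = n] (mod p)"
  shows "f m = f n"
proof -
  obtain k where "m = n + p * k"
    using cong_sym[OF assms(2)] unfolding cong_iff_lin by blast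
  with periodic_add_mult[of f p, OF assms(1)] show ?thesis by simp
qed

text \<open>As a is invertible modulo p, the map b -> a b + c permutes the residues. The uses are
  translation by 1, reflection, and multiplication by a unit.\<close>

lemma sum_residues_affine:
  fixes f :: "int \<Rightarrow> 'a::comm_monoid_add"
  assumes "0 < p" "\<And>n. f (n + p) = f n" "coprime a p"
  shows "(\<Sum>b\<in>{0..<p}. f (a * b + c)) = (\<Sum>b\<in>{0..<p}. f b)"
proof -
  define h where "h = (\<lambda>b. (a * b + c) mod p)"
  have inj: "inj_on h {0..<p}"
  proof (rule inj_onI)
    fix x y assume xy: "x \<in> {0..<p}" "y \<in> {0..<p}" "h x = h y"
    then have "[a * x + c = a * y + c] (mod p)" by (simp add: h_def cong_def)
    then have "[a * x = a * y] (mod p)" by (simp add: cong_add_rcancel)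
    then have "[x = y] (mod p)" using assms(3) by (simp add: cong_mult_lcancel)
    then show "x = y" using xy by (simp add: cong_def)
  qed
  have "h ` {0..<p} = {0..<p}"
    using inj assms(1) by (intro endo_inj_surj) (auto simp: h_def)
  then have "(\<Sum>b\<in>{0..<p}. f b) = (\<Sum>b\<in>h ` {0..<p}. f b)" by simp
  also have "\<dots> = (\<Sum>b\<in>{0..<p}. f (h b))"
    by (simp add: sum.reindex[OF inj])
  also have "\<dots> = (\<Sum>b\<in>{0..<p}. f (a * b + c))"
    by (intro sum.cong refl periodic_cong[of f p, OF assms(2)]) (simp add: h_def cong_def)
  finally show ?thesis by simp
qed

section \<open>Additive characters and their orthogonality\<close>

definition add_char :: "nat \<Rightarrow> int \<Rightarrow> complex" where
  "add_char q n = cis (2 * pi * real_of_int n / real q)"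

lemma add_char_add: "add_char q (m + n) = add_char q m * add_char q n"
  by (simp add: add_char_def cis_mult add_divide_distrib algebra_simps)

lemma add_char_0 [simp]: "add_char q 0 = 1"
  by (simp add: add_char_def)

lemma cnj_add_char: "cnj (add_char q n) = add_char q (- n)"
  by (simp add: add_char_def cis_cnj)

lemma add_char_self [simp]: "0 < q \<Longrightarrow> add_char q (int q) = 1"
  by (simp add: add_char_def)

lemma add_char_periodic: "0 < q \<Longrightarrow> add_char q (n + int q) = add_char q n"
  by (simp add: add_char_add)

lemma add_char_eq_1_iff:
  assumes "0 < q"
  shows "add_char q n = 1 \<longleftrightarrow> int q dvd n"
proof
  assume "add_char q n = 1"
  then have "cos (2 * pi * real_of_int n / real q) = 1"
    by (simp add: add_char_def complex_eq_iff)
  then obtain k :: int where "2 * pi * real_of_int n / real q = real_of_int k * 2 * pi"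
    unfolding cos_one_2pi_int by blast
  then have "real_of_int n = real_of_int (int q * k)"
    using assms by (simp add: field_simps)
  then have "n = int q * k" by (simp only: of_int_eq_iff)
  then show "int q dvd n" by simp
next
  assume "int q dvd n"
  then obtain k where "n = 0 + int q * k" by auto
  with periodic_add_mult[of "add_char q" "int q" 0 k] assms
  show "add_char q n = 1" by (simp add: add_char_periodic)
qed

text \<open>Translating a by 1 permutes the residues and multiplies the sum by
  \<open>add_char q n\<close>. If that factor is not 1, the sum vanishes.\<close>

lemma sum_add_char:
  assumes "0 < q"
  shows "(\<Sum>a\<in>{0..<int q}. add_char q (a * n)) = (if int q dvd n then of_nat q else 0)"
proof (cases "int q dvd n")
  case True
  then have "add_char q (a * n) = 1" for a
    by (simp add: add_char_eq_1_iff assms)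
  with True show ?thesis by simp
next
  case False
  define S where "S = (\<Sum>a\<in>{0..<int q}. add_char q (a * n))"
  have "add_char q ((a + int q) * n) = add_char q (a * n)" for a
    using add_char_eq_1_iff[OF assms, of "int q * n"] by (simp add: distrib_right add_char_add)
  then have "(\<Sum>a\<in>{0..<int q}. add_char q ((1 * a + 1) * n)) = S"
    unfolding S_def using assms
    by (intro sum_residues_affine[of "int q" "\<lambda>a. add_char q (a * n)" 1 1]) auto
  moreover have "(\<Sum>a\<in>{0..<int q}. add_char q ((1 * a + 1) * n)) = S * add_char q n"
    unfolding S_def by (simp add: distrib_right add_char_add sum_distrib_right)
  ultimately have "S * (add_char q n - 1) = 0" by (simp add: algebra_simps)
  with False show ?thesis by (simp add: add_char_eq_1_iff assms S_def)
qed

section \<open>The discrete cosine transform of the absolute sine\<close>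

lemma cos_eq_Re_add_char:
  "cos (2 * pi * real_of_int n / real q) = Re (add_char q n)"
  by (simp add: add_char_def)

text \<open>Discrete Fourier inversion in real form: reflection l -> -l kills the sine transform of
  an even function, and orthogonality of the cosines singles out the residue of k.\<close>

lemma even_cosine_inversion:
  fixes f :: "int \<Rightarrow> real"
  assumes q: "0 < q" and per: "\<And>n. f (n + int q) = f n" and even: "\<And>n. f (- n) = f n"
  shows "real q * f k = (\<Sum>j\<in>{0..<int q}. cos (2 * pi * real_of_int (j * k) / real q) *
           (\<Sum>l\<in>{0..<int q}. f l * cos (2 * pi * real_of_int (j * l) / real q)))"
proof -
  let ?c = "\<lambda>n. cos (2 * pi * real_of_int n / real q)"
  let ?s = "\<lambda>n. sin (2 * pi * real_of_int n / real q)"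
  have orth: "(\<Sum>j\<in>{0..<int q}. ?c (j * n)) = (if int q dvd n then real q else 0)" for n
    by (simp only: cos_eq_Re_add_char Re_sum[symmetric] sum_add_char[OF q]) simp
  have sper: "?s (n + int q) = ?s n" for n
    using q sin.plus_of_nat[of "2 * pi * real_of_int n / real q" 1]
    by (simp add: add_divide_distrib distrib_left)
  have odd: "(\<Sum>l\<in>{0..<int q}. f l * ?s (j * l)) = 0" for j
  proof -
    have p: "?s (j * (n + int q)) = ?s (j * n)" for n
      using periodic_add_mult[of ?s "int q" "j * n" j] sper by (simp add: algebra_simps)
    have "(\<Sum>l\<in>{0..<int q}. f ((-1) * l + 0) * ?s (j * ((-1) * l + 0))) = (\<Sum>l\<in>{0..<int q}. f l * ?s (j * l))"
      using q per p by (intro sum_residues_affine[of "int q" "\<lambda>l. f l * ?s (j * l)" "-1" 0]) auto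
    then show ?thesis by (simp add: even sum_negf)
  qed
  have "real q * f k = (\<Sum>l\<in>{0..<int q}. if l = k mod int q then real q * f l else 0)"
    using q per periodic_cong[of f "int q" k "k mod int q"] by (simp add: cong_def)
  also have "\<dots> = (\<Sum>l\<in>{0..<int q}. f l * (\<Sum>j\<in>{0..<int q}. ?c (j * (k - l))))"
  proof (intro sum.cong refl)
    fix l assume l: "l \<in> {0..<int q}"
    then have "int q dvd k - l \<longleftrightarrow> l = k mod int q"
      by (auto simp: mod_eq_dvd_iff[symmetric])
    then show "(if l = k mod int q then real q * f l else 0) = f l * (\<Sum>j\<in>{0..<int q}. ?c (j * (k - l)))"
      unfolding orth by simp
  qed
  also have "\<dots> = (\<Sum>j\<in>{0..<int q}. \<Sum>l\<in>{0..<int q}. f l * ?c (j * (k - l)))"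
    by (simp only: sum_distrib_left) (rule sum.swap)
  also have "\<dots> = (\<Sum>j\<in>{0..<int q}. ?c (j * k) * (\<Sum>l\<in>{0..<int q}. f l * ?c (j * l)))"
  proof (intro sum.cong refl)
    fix j
    have "?c (j * (k - l)) = ?c (j * k) * ?c (j * l) + ?s (j * k) * ?s (j * l)" for l
      by (simp add: cos_diff[symmetric] diff_divide_distrib right_diff_distrib)
    then have "(\<Sum>l\<in>{0..<int q}. f l * ?c (j * (k - l)))
        = ?c (j * k) * (\<Sum>l\<in>{0..<int q}. f l * ?c (j * l))
        + ?s (j * k) * (\<Sum>l\<in>{0..<int q}. f l * ?s (j * l))"
      by (simp add: sum_distrib_left sum.distrib[symmetric] algebra_simps)
    then show "(\<Sum>l\<in>{0..<int q}. f l * ?c (j * (k - l)))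
        = ?c (j * k) * (\<Sum>l\<in>{0..<int q}. f l * ?c (j * l))"
      by (simp only: odd mult_zero_right add_0_right)
  qed
  finally show ?thesis .
qed

text \<open>With y half the step, the sum telescopes to cos y - cos ((2q - 1) y). Since (2q - 1) y =
  m pi - y with m odd, the second cosine is -cos y. Negative m is allowed because the frequency j =
  0 leads to m = -1.\<close>

lemma sum_sin_odd_multiple:
  fixes m :: int
  assumes q: "0 < q" and "odd m" and "sin (pi * real_of_int m / (2 * real q)) \<noteq> 0"
  shows "(\<Sum>l<q. sin (real l * (pi * real_of_int m / real q))) = cot (pi * real_of_int m / (2 * real q))"
proof -
  define y where "y = pi * real_of_int m / (2 * real q)"
  have tel: "2 * sin y * (\<Sum>l<n. sin (real l * (2 * y))) = cos y - cos ((2 * real n - 1) * y)" for n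
  proof (induction n)
    case (Suc n)
    have "y - real n * (2 * y) = - ((2 * real n - 1) * y)" "y + real n * (2 * y) = (2 * real (Suc n) - 1) * y"
      by (simp_all add: algebra_simps)
    then have "2 * (sin y * sin (real n * (2 * y))) = cos ((2 * real n - 1) * y) - cos ((2 * real (Suc n) - 1) * y)"
      by (simp only: sin_times_sin cos_minus) simp
    with Suc show ?case by (simp add: algebra_simps)
  qed simp
  have "(2 * real q - 1) * y = real_of_int m * pi - y"
    using q by (simp add: y_def field_simps)
  moreover have "cos (real_of_int m * pi) = -1" "sin (real_of_int m * pi) = 0"
    using \<open>odd m\<close> by (simp_all add: cos_npi_int sin_npi_int mult.commute)
  ultimately have "cos ((2 * real q - 1) * y) = - cos y" by (simp add: cos_diff)
  with tel[of q] have "sin y * (\<Sum>l<q. sin (real l * (2 * y))) = cos y" by simp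
  then have "(\<Sum>l<q. sin (real l * (2 * y))) = cot y"
    using assms(3) by (simp only: y_def[symmetric] cot_def eq_divide_eq) (simp add: mult.commute)
  moreover have "2 * y = pi * real_of_int m / real q" by (simp add: y_def)
  ultimately show ?thesis by (simp only: y_def[symmetric])
qed

lemma cosine_transform_abs_sin:
  fixes j :: int
  assumes q: "0 < q" and j: "0 \<le> j" "j < int q"
  shows "(\<Sum>l\<in>{0..<int q}. \<bar>sin (pi * real_of_int l / real q)\<bar> * cos (2 * pi * real_of_int (j * l) / real q))
    = (cot (pi * real_of_int (2 * j + 1) / (2 * real q)) - cot (pi * real_of_int (2 * j - 1) / (2 * real q))) / 2"
proof -
  have pos: "0 < sin (pi * real_of_int m / (2 * real q))" if "0 < m" "m < 2 * int q" for m
  proof (rule sin_gt_zero)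
    have "real_of_int m < 2 * real q" using that by linarith
    then show "pi * real_of_int m / (2 * real q) < pi" using q by (simp add: field_simps)
  qed (use that q in auto)
  have "sin (pi * real_of_int (2 * j + 1) / (2 * real q)) \<noteq> 0"
    using pos[of "2 * j + 1"] j by simp
  note plus = sum_sin_odd_multiple[OF q _ this]
  have "sin (pi * real_of_int (2 * j - 1) / (2 * real q)) \<noteq> 0"
  proof (cases "j = 0")
    case True
    then show ?thesis using pos[of 1] q by simp
  next
    case False
    then show ?thesis using pos[of "2 * j - 1"] j by simp
  qed
  note minus = sum_sin_odd_multiple[OF q _ this]
  have "(\<Sum>l\<in>{0..<int q}. \<bar>sin (pi * real_of_int l / real q)\<bar> * cos (2 * pi * real_of_int (j * l) / real q))
      = (\<Sum>l<q. \<bar>sin (pi * real l / real q)\<bar> * cos (2 * pi * (real_of_int j * real l) / real q))"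
    by (rule sum.reindex_bij_witness[of _ int nat]) auto
  also have "\<dots> = (\<Sum>l<q. (sin (real l * (pi * real_of_int (2 * j + 1) / real q))
      - sin (real l * (pi * real_of_int (2 * j - 1) / real q))) / 2)"
  proof (intro sum.cong refl)
    fix l assume "l \<in> {..<q}"
    then have "pi * real l / real q \<le> pi" by (simp add: field_simps)
    then have "\<bar>sin (pi * real l / real q)\<bar> = sin (pi * real l / real q)"
      by (intro abs_of_nonneg sin_ge_zero) auto
    moreover have "pi * real l / real q + 2 * pi * (real_of_int j * real l) / real q
        = real l * (pi * real_of_int (2 * j + 1) / real q)"
      and "pi * real l / real q - 2 * pi * (real_of_int j * real l) / real q
        = - (real l * (pi * real_of_int (2 * j - 1) / real q))"
      using q by (simp_all add: field_simps)
    ultimately show "\<bar>sin (pi * real l / real q)\<bar> * cos (2 * pi * (real_of_int j * real l) / real q)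
      = (sin (real l * (pi * real_of_int (2 * j + 1) / real q))
      - sin (real l * (pi * real_of_int (2 * j - 1) / real q))) / 2"
      by (simp only: sin_times_cos sin_minus) simp
  qed
  also have "\<dots> = ((\<Sum>l<q. sin (real l * (pi * real_of_int (2 * j + 1) / real q)))
      - (\<Sum>l<q. sin (real l * (pi * real_of_int (2 * j - 1) / real q)))) / 2"
    by (simp only: sum_divide_distrib[symmetric] sum_subtractf)
  finally show ?thesis using plus minus by simp
qed

text \<open>
  The cosine coefficients of \<open>\<bar>sin (\<pi> k / q)\<bar>\<close> are nonpositive apart from the constant one, which is
  at most \<open>2 / \<pi>\<close>, and they sum to \<open>0\<close> because the function vanishes at \<open>k = 0\<close>. A lower bound for
  cosine sums therefore yields an upper bound with the sharp factor \<open>2 / \<pi>\<close>.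
\<close>

lemma sum_abs_sin_div_le:
  fixes k :: int
  assumes q: "2 \<le> q" and L: "0 < L"
  shows "(\<Sum>a=1..L. \<bar>sin (pi * real_of_int (int a * k) / real q)\<bar> / real a)
      \<le> 2 / pi * ((\<Sum>a=1..L. 1 / real a) + ln 2 + 2 / real L)"
proof -
  have q0: "0 < q" using q by simp
  define f where "f = (\<lambda>n::int. \<bar>sin (pi * real_of_int n / real q)\<bar>)"
  define F where "F = (\<lambda>j::int. \<Sum>l\<in>{0..<int q}. f l * cos (2 * pi * real_of_int (j * l) / real q))"
  define T where "T = (\<lambda>j::int. \<Sum>a=1..L. cos (2 * pi * real_of_int (j * (int a * k)) / real q) / real a)"
  define E where "E = ln 2 + 2 / real L"
  have per: "f (n + int q) = f n" for n
    using q by (simp add: f_def distrib_left add_divide_distrib)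
  have even: "f (- n) = f n" for n
    by (simp add: f_def)
  have inv: "real q * f n = (\<Sum>j\<in>{0..<int q}. cos (2 * pi * real_of_int (j * n) / real q) * F j)" for n
    unfolding F_def by (rule even_cosine_inversion[OF q0 per even])
  have F: "F j = (cot (pi * real_of_int (2 * j + 1) / (2 * real q)) - cot (pi * real_of_int (2 * j - 1) / (2 * real q))) / 2"
    if "0 \<le> j" "j < int q" for j
    using cosine_transform_abs_sin[OF q0 that] by (simp add: F_def f_def)
  have Fneg: "F j \<le> 0" if "1 \<le> j" "j < int q" for j
  proof -
    have "real_of_int (2 * j + 1) < 2 * real q" using that by linarith
    then have "pi * real_of_int (2 * j + 1) < pi * (2 * real q)"
      by (intro mult_strict_left_mono) auto
    then have "pi * real_of_int (2 * j + 1) / (2 * real q) < pi"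
      using q by (simp add: divide_less_eq)
    then have "cot (pi * real_of_int (2 * j + 1) / (2 * real q)) \<le> cot (pi * real_of_int (2 * j - 1) / (2 * real q))"
      using that q by (intro cot_antimono divide_right_mono mult_left_mono) auto
    then show ?thesis using F[of j] that by simp
  qed
  \<comment> \<open>For j = 0 the two angles are opposite and cotangent is odd. The bound cot y <= 1
    / y then yields 2 / pi, the mean of the absolute sine.\<close>
  have F0: "F 0 = cot (pi / (2 * real q))"
    using F[of 0] q by (simp add: cot_def)
  also have "\<dots> \<le> 1 / (pi / (2 * real q))"
    using q by (intro cot_le_inverse) (auto simp: field_simps)
  finally have F0le: "F 0 / real q \<le> 2 / pi"
    using q by (simp add: field_simps)
  have split: "(\<Sum>j\<in>{0..<int q}. g j) = g 0 + (\<Sum>j\<in>{1..<int q}. g j)" for g :: "int \<Rightarrow> real"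
  proof -
    have "{0..<int q} = insert 0 {1..<int q}" using q by auto
    then show ?thesis by simp
  qed
  have "(\<Sum>j\<in>{0..<int q}. F j) = 0" using inv[of 0] by (simp add: f_def)
  then have Fsum: "(\<Sum>j\<in>{1..<int q}. F j) = - F 0" by (simp add: split)
  have T: "- E \<le> T j" for j
  proof -
    have eq: "2 * pi * real_of_int (j * (int a * k)) / real q = real a * (2 * pi * real_of_int (j * k) / real q)" for a
      by (simp add: field_simps)
    show ?thesis
      unfolding T_def E_def eq using sum_cos_div_ge[OF L, of "2 * pi * real_of_int (j * k) / real q"] by simp
  qed
  have "real q * (\<Sum>a=1..L. f (int a * k) / real a)
      = (\<Sum>a=1..L. \<Sum>j\<in>{0..<int q}. F j * (cos (2 * pi * real_of_int (j * (int a * k)) / real q) / real a))"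
    unfolding sum_distrib_left
  proof (intro sum.cong refl)
    fix a
    show "real q * (f (int a * k) / real a)
        = (\<Sum>j\<in>{0..<int q}. F j * (cos (2 * pi * real_of_int (j * (int a * k)) / real q) / real a))"
      unfolding times_divide_eq_right inv sum_divide_distrib by (intro sum.cong refl) simp
  qed
  also have "\<dots> = (\<Sum>j\<in>{0..<int q}. F j * T j)"
    unfolding T_def sum_distrib_left by (rule sum.swap)
  also have "\<dots> = F 0 * (\<Sum>a=1..L. 1 / real a) + (\<Sum>j\<in>{1..<int q}. F j * T j)"
    by (simp add: split T_def)
  also have "(\<Sum>j\<in>{1..<int q}. F j * T j) \<le> (\<Sum>j\<in>{1..<int q}. F j * (- E))"
    using Fneg T by (intro sum_mono mult_left_mono_neg) auto
  also have "\<dots> = F 0 * E" by (simp add: sum_distrib_right[symmetric] Fsum sum_negf)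
  finally have "(\<Sum>a=1..L. f (int a * k) / real a) \<le> F 0 / real q * ((\<Sum>a=1..L. 1 / real a) + E)"
    using q by (simp add: field_simps)
  also have "\<dots> \<le> 2 / pi * ((\<Sum>a=1..L. 1 / real a) + E)"
    using F0le by (intro mult_right_mono) (auto simp: E_def intro!: add_nonneg_nonneg sum_nonneg)
  finally show ?thesis by (simp add: f_def E_def add.assoc)
qed

section \<open>Gauss sums\<close>

locale dirichlet_char =
  fixes q :: nat and chi :: "int \<Rightarrow> complex"
  assumes character: "dirichlet_character q chi"
begin

lemma modulus_pos: "0 < q"
  and chi_mult: "chi (m * n) = chi m * chi n"
  and chi_periodic: "chi (n + int q) = chi n"
  and chi_nonzero_iff: "chi n \<noteq> 0 \<longleftrightarrow> coprime n (int q)"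
  using character by (auto simp: dirichlet_character_def)

lemma chi_1: "chi 1 = 1"
  using chi_mult[of 1 1] chi_nonzero_iff[of 1] by auto

lemma chi_cong: "[m = n] (mod int q) \<Longrightarrow> chi m = chi n"
  by (rule periodic_cong[of chi "int q"]) (rule chi_periodic)

lemma chi_power: "chi (n ^ k) = chi n ^ k"
  by (induction k) (simp_all add: chi_1 chi_mult)

text \<open>Euler's theorem makes the value at a unit a root of unity.\<close>

lemma norm_chi:
  "norm (chi n) = (if coprime n (int q) then 1 else 0)"
proof (cases "coprime n (int q)")
  case True
  define m where "m = nat (n mod int q)"
  have "[int m = n] (mod int q)"
    using modulus_pos by (simp add: m_def cong_def)
  then have eq: "chi n = chi (int m)" and "coprime (int m) (int q)"
    using chi_cong[of "int m" n] True cong_imp_coprime[of n "int m" "int q"] by (auto intro: cong_sym)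
  then have "coprime m q" by simp
  have "[m ^ totient q = 1] (mod q)" using \<open>coprime m q\<close> by (rule euler_theorem)
  then have "[int m ^ totient q = 1] (mod int q)"
    by (metis cong_int_iff of_nat_1 of_nat_power)
  then have "chi n ^ totient q = 1"
    using chi_cong[of "int m ^ totient q" 1] unfolding eq by (simp add: chi_power chi_1)
  then have "norm (chi n) ^ totient q = 1" by (metis norm_one norm_power)
  moreover have "0 < totient q" using modulus_pos by simp
  ultimately have "norm (chi n) = 1"
    using power_eq_imp_eq_base[of "norm (chi n)" "totient q" 1] by simp
  with True show ?thesis by simp
next
  case False
  then have "chi n = 0" using chi_nonzero_iff by blast
  with False show ?thesis by simp
qed

lemma norm_chi_le_1: "norm (chi n) \<le> 1"
  by (simp add: norm_chi)

definition gauss_sum :: "int \<Rightarrow> complex" where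
  "gauss_sum n = (\<Sum>a\<in>{0..<int q}. chi a * add_char q (a * n))"

lemma gauss_term_periodic:
  "chi (a + int q) * add_char q ((a + int q) * n) = chi a * add_char q (a * n)"
  using periodic_add_mult[of "add_char q" "int q" "a * n" n] modulus_pos
  by (simp add: chi_periodic add_char_periodic distrib_right)

text \<open>Substitute b -> a b in the Gauss sum.\<close>

lemma gauss_sum_mult:
  assumes "coprime a (int q)"
  shows "chi a * gauss_sum (a * n) = gauss_sum n"
proof -
  have "chi a * gauss_sum (a * n) = (\<Sum>b\<in>{0..<int q}. chi (a * b + 0) * add_char q ((a * b + 0) * n))"
    by (simp add: gauss_sum_def sum_distrib_left chi_mult mult_ac)
  also have "\<dots> = gauss_sum n"
    unfolding gauss_sum_def using modulus_pos assms
    by (intro sum_residues_affine[of "int q" "\<lambda>b. chi b * add_char q (b * n)" a 0] gauss_term_periodic) auto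
  finally show ?thesis .
qed

lemma gauss_sum_cong:
  assumes "[m = n] (mod int q)"
  shows "gauss_sum m = gauss_sum n"
proof -
  have "add_char q (a * m) = add_char q (a * n)" for a
    using periodic_cong[of "add_char q" "int q" "a * m" "a * n"] assms modulus_pos
    by (simp add: add_char_periodic cong_scalar_left)
  then show ?thesis by (simp add: gauss_sum_def)
qed

text \<open>Parseval's identity: after expanding the squares, the sum over n of additive characters
  removes all terms off the diagonal a = b.\<close>

lemma sum_norm_gauss_sum:
  "(\<Sum>n\<in>{0..<int q}. (norm (gauss_sum n))\<^sup>2) = real q * (\<Sum>n\<in>{0..<int q}. (norm (chi n))\<^sup>2)"
proof -
  let ?R = "{0..<int q}"
  have "complex_of_real (\<Sum>n\<in>?R. (norm (gauss_sum n))\<^sup>2) = (\<Sum>n\<in>?R. gauss_sum n * cnj (gauss_sum n))"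
    by (simp only: of_real_sum complex_norm_square)
  also have "\<dots> = (\<Sum>n\<in>?R. \<Sum>a\<in>?R. \<Sum>b\<in>?R. chi a * cnj (chi b) * add_char q (n * (a - b)))"
  proof (intro sum.cong refl)
    fix n
    have "chi a * add_char q (a * n) * cnj (chi b * add_char q (b * n))
        = chi a * cnj (chi b) * add_char q (n * (a - b))" for a b
    proof -
      have "add_char q (n * (a - b)) = add_char q (a * n) * add_char q (- (b * n))"
        unfolding add_char_add[symmetric] by (simp add: algebra_simps)
      then show ?thesis by (simp add: cnj_add_char mult_ac)
    qed
    then show "gauss_sum n * cnj (gauss_sum n)
        = (\<Sum>a\<in>?R. \<Sum>b\<in>?R. chi a * cnj (chi b) * add_char q (n * (a - b)))"
      unfolding gauss_sum_def cnj_sum sum_product by (simp only:)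
  qed
  also have "\<dots> = (\<Sum>a\<in>?R. \<Sum>n\<in>?R. \<Sum>b\<in>?R. chi a * cnj (chi b) * add_char q (n * (a - b)))"
    by (rule sum.swap)
  also have "\<dots> = (\<Sum>a\<in>?R. \<Sum>b\<in>?R. \<Sum>n\<in>?R. chi a * cnj (chi b) * add_char q (n * (a - b)))"
    by (intro sum.cong refl sum.swap)
  also have "\<dots> = (\<Sum>a\<in>?R. \<Sum>b\<in>?R. if b = a then chi a * cnj (chi b) * of_nat q else 0)"
  proof (intro sum.cong refl)
    fix a b assume "a \<in> ?R" "b \<in> ?R"
    then have "int q dvd a - b \<longleftrightarrow> b = a"
      by (auto simp: mod_eq_dvd_iff[symmetric])
    then show "(\<Sum>n\<in>?R. chi a * cnj (chi b) * add_char q (n * (a - b)))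
        = (if b = a then chi a * cnj (chi b) * of_nat q else 0)"
      by (simp add: sum_distrib_left[symmetric] sum_add_char[OF modulus_pos])
  qed
  also have "\<dots> = (\<Sum>a\<in>?R. chi a * cnj (chi a) * of_nat q)"
    by (intro sum.cong refl) simp
  also have "\<dots> = complex_of_real (real q * (\<Sum>a\<in>?R. (norm (chi a))\<^sup>2))"
    by (simp only: of_real_mult of_real_sum complex_norm_square of_real_of_nat_eq sum_distrib_left mult.commute)
  finally show ?thesis by (simp only: of_real_eq_iff)
qed

end

locale primitive_char = dirichlet_char +
  assumes primitive: "primitive_dirichlet_character q chi"
begin

text \<open>Let d = gcd (n, q) > 1. By primitivity e = q / d is not an induced modulus, so some unit
  a = 1 mod e has chi a different from 1. Since a n = n mod q, the Gauss sum at n is unchanged by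
  the factor chi a and must be zero.\<close>

lemma gauss_sum_not_coprime:
  assumes "\<not> coprime n (int q)"
  shows "gauss_sum n = 0"
proof -
  define d where "d = gcd n (int q)"
  have d: "d dvd n" "d dvd int q" "0 < d"
    using modulus_pos by (auto simp: d_def)
  have "d \<noteq> 1" using assms by (simp add: d_def coprime_iff_gcd_eq_1)
  define e where "e = nat (int q div d)"
  have e: "int e * d = int q" using d by (simp add: e_def pos_imp_zdiv_nonneg_iff)
  have "e dvd q"
    using e by (metis dvd_triv_left int_dvd_int_iff)
  have "int e < int q"
  proof -
    have "0 < int e" using e modulus_pos by (cases "e = 0") auto
    moreover have "1 < d" using d \<open>d \<noteq> 1\<close> by linarith
    ultimately have "int e * 1 < int e * d" by (intro mult_strict_left_mono)
    then show ?thesis using e by simp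
  qed
  then have "\<not> induced_modulus q chi e"
    using primitive by (auto simp: primitive_dirichlet_character_def)
  then obtain a where a: "coprime a (int q)" "[a = 1] (mod int e)" "chi a \<noteq> 1"
    using \<open>e dvd q\<close> by (auto simp: induced_modulus_def)
  have "int e * d dvd (a - 1) * n"
    using a(2) d(1) by (intro mult_dvd_mono) (auto simp: cong_iff_dvd_diff)
  then have "int q dvd (a - 1) * n" by (simp only: e)
  then have "[a * n = n] (mod int q)"
    by (simp add: cong_iff_dvd_diff algebra_simps)
  then have "gauss_sum (a * n) = gauss_sum n" by (rule gauss_sum_cong)
  then have "chi a * gauss_sum n = gauss_sum n"
    using gauss_sum_mult[OF a(1), of n] by simp
  then have "(chi a - 1) * gauss_sum n = 0" by (simp add: algebra_simps)
  with a(3) show ?thesis by simp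
qed

text \<open>Separability of Gauss sums. For units it follows from the substitution rule and |chi n|
  = 1; for the other n both sides vanish, and this is where primitivity enters.\<close>

lemma cnj_chi_gauss_sum: "cnj (chi n) * gauss_sum 1 = gauss_sum n"
proof (cases "coprime n (int q)")
  case True
  then have "cnj (chi n) * chi n = 1"
    using complex_norm_square[of "chi n"] by (simp add: norm_chi mult.commute)
  moreover have "gauss_sum 1 = chi n * gauss_sum n"
    using gauss_sum_mult[OF True, of 1] by simp
  ultimately show ?thesis by (simp flip: mult.assoc)
next
  case False
  then have "chi n = 0" using chi_nonzero_iff by blast
  with False show ?thesis by (simp add: gauss_sum_not_coprime)
qed

text \<open>Separability inserted into Parseval's identity produces the same positive factor
  \<open>?S\<close> on both sides.\<close>

lemma norm_gauss_sum: "norm (gauss_sum 1) = sqrt (real q)"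
proof -
  let ?S = "\<Sum>n\<in>{0..<int q}. (norm (chi n))\<^sup>2"
  have "(norm (gauss_sum n))\<^sup>2 = (norm (gauss_sum 1))\<^sup>2 * (norm (chi n))\<^sup>2" for n
    unfolding cnj_chi_gauss_sum[of n, symmetric] by (simp add: norm_mult power_mult_distrib)
  then have "(\<Sum>n\<in>{0..<int q}. (norm (gauss_sum n))\<^sup>2) = (norm (gauss_sum 1))\<^sup>2 * ?S"
    unfolding sum_distrib_left by (intro sum.cong refl)
  then have "(norm (gauss_sum 1))\<^sup>2 * ?S = real q * ?S"
    by (rule trans[OF sym sum_norm_gauss_sum])
  \<comment> \<open>The witness is \<open>1 mod int q\<close> rather than 1, so that q = 1 with its
    only residue 0 is covered.\<close>
  moreover have "0 < ?S"
  proof (rule sum_pos2)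
    show "1 mod int q \<in> {0..<int q}" using modulus_pos by simp
    have "chi (1 mod int q) = 1"
      using chi_cong[of "1 mod int q" 1] by (simp add: chi_1 cong_def)
    then show "0 < (norm (chi (1 mod int q)))\<^sup>2" by simp
  qed auto
  ultimately have "(norm (gauss_sum 1))\<^sup>2 = real q" by simp
  then show ?thesis using real_sqrt_unique[of "norm (gauss_sum 1)"] by simp
qed

end

section \<open>Smoothing\<close>

lemma int_interval_extend: "{- int (Suc K)..int (Suc K)} = insert (- int (Suc K)) (insert (int (Suc K)) {- int K..int K})"
  by auto

text \<open>Pair h with -h. Cosine and sine both satisfy the hypothesis, which allows both parities
  of the character to be treated at once.\<close>

lemma sum_symmetric_shift:
  fixes g :: "real \<Rightarrow> real"
  assumes "\<And>v w. g (v + w) + g (v - w) = 2 * g v * cos w"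
  shows "(\<Sum>h\<in>{- int K..int K}. g (v + 2 * real_of_int h * x))
    = g v * (\<Sum>h\<in>{- int K..int K}. cos (2 * real_of_int h * x))"
proof (induction K)
  case (Suc K)
  then show ?case
    using assms[of v "2 * real_of_int (int (Suc K)) * x"] cos_minus[of "2 * real_of_int (int (Suc K)) * x"]
    unfolding int_interval_extend by (simp add: algebra_simps)
qed simp

text \<open>The closed form of the Dirichlet kernel bounds it by 1 / |sin x|, the second cosecant
  gained by averaging.\<close>

lemma sin_times_Dirichlet_kernel:
  "sin x * (\<Sum>h\<in>{- int K..int K}. cos (2 * real_of_int h * x)) = sin ((2 * real K + 1) * x)"
proof (induction K)
  case (Suc K)
  have "sin x * cos (2 * real (Suc K) * x) = (sin ((2 * real (Suc K) + 1) * x) - sin ((2 * real K + 1) * x)) / 2"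
  proof -
    have "x + 2 * real (Suc K) * x = (2 * real (Suc K) + 1) * x" "x - 2 * real (Suc K) * x = - ((2 * real K + 1) * x)"
      by (simp_all add: algebra_simps)
    then show ?thesis by (simp only: sin_times_cos sin_minus) simp
  qed
  with Suc show ?case
    using cos_minus[of "2 * real_of_int (int (Suc K)) * x"]
    unfolding int_interval_extend by (simp add: algebra_simps)
qed simp

text \<open>A shift by one exchanges a single term at each end of the interval, so it costs at most
  2.\<close>

lemma sum_shift_diff_le:
  fixes f :: "int \<Rightarrow> complex"
  assumes "\<And>n. norm (f n) \<le> 1" "M \<le> N"
  shows "norm ((\<Sum>n=M..N. f n) - (\<Sum>n=M..N. f (n + h))) \<le> 2 * \<bar>real_of_int h\<bar>"
proof -
  define F where "F = (\<lambda>h. \<Sum>n=M..N. f (n + h))"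
  have step: "norm (F (h + 1) - F h) \<le> 2" for h
  proof -
    have "F (h + 1) = (\<Sum>n=M+1..N+1. f (n + h))"
      unfolding F_def by (rule sum.reindex_bij_witness[of _ "\<lambda>n. n - 1" "\<lambda>n. n + 1"]) (auto simp: algebra_simps)
    moreover have "{M..N+1} = insert M {M+1..N+1}" "{M..N+1} = insert (N + 1) {M..N}"
      using assms(2) by auto
    then have "f (M + h) + (\<Sum>n=M+1..N+1. f (n + h)) = f (N + 1 + h) + F h"
      unfolding F_def by (metis (no_types, lifting) sum.insert finite_atLeastAtMost_int atLeastAtMost_iff
          add_le_same_cancel1 not_one_le_zero zle_add1_eq_le less_irrefl)
    ultimately have "F (h + 1) - F h = f (N + 1 + h) - f (M + h)" by (simp add: algebra_simps)
    also have "norm \<dots> \<le> norm (f (N + 1 + h)) + norm (f (M + h))" by (rule norm_triangle_ineq4)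
    also have "\<dots> \<le> 2" using assms(1)[of "N + 1 + h"] assms(1)[of "M + h"] by linarith
    finally show ?thesis .
  qed
  have up: "norm (F (h + int k) - F h) \<le> 2 * real k" for h k
  proof (induction k)
    case (Suc k)
    have "norm (F (h + int (Suc k)) - F h) \<le> norm (F (h + int k + 1) - F (h + int k)) + norm (F (h + int k) - F h)"
      using norm_triangle_ineq[of "F (h + int k + 1) - F (h + int k)" "F (h + int k) - F h"]
      by (simp add: algebra_simps)
    with Suc step[of "h + int k"] show ?case by simp
  qed simp
  have "norm (F 0 - F h) \<le> 2 * \<bar>real_of_int h\<bar>"
  proof (cases "0 \<le> h")
    case True
    then show ?thesis using up[of 0 "nat h"] by (simp add: norm_minus_commute)
  next
    case False
    then show ?thesis using up[of h "nat (- h)"] by simp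
  qed
  then show ?thesis by (simp add: F_def)
qed

text \<open>The H translates with |h| <= K cost 2|h| each, in total 2K(K + 1) <= H^2 / 2. Division
  by H gives the loss H / 2.\<close>

lemma norm_sum_le_average:
  fixes f :: "int \<Rightarrow> complex" and K :: nat
  assumes "\<And>n. norm (f n) \<le> 1" "M \<le> N"
  defines "H \<equiv> 2 * real K + 1"
  shows "norm (\<Sum>n=M..N. f n) \<le> H / 2 + norm (\<Sum>h\<in>{- int K..int K}. \<Sum>n=M..N. f (n + h)) / H"
proof -
  let ?I = "{- int K..int K}"
  let ?S = "\<Sum>n=M..N. f n"
  have H: "0 < H" by (simp add: H_def)
  have abs_sum: "(\<Sum>h\<in>{- int k..int k}. 2 * \<bar>real_of_int h\<bar>) = 2 * real k * (real k + 1)" for k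
  proof (induction k)
    case (Suc k)
    then show ?case unfolding int_interval_extend by (simp add: algebra_simps)
  qed simp
  have "of_real H * ?S = (\<Sum>h\<in>?I. ?S)" by (simp add: H_def)
  also have "\<dots> = (\<Sum>h\<in>?I. ?S - (\<Sum>n=M..N. f (n + h))) + (\<Sum>h\<in>?I. \<Sum>n=M..N. f (n + h))"
    by (simp add: sum_subtractf)
  also have "norm \<dots> \<le> (\<Sum>h\<in>?I. 2 * \<bar>real_of_int h\<bar>) + norm (\<Sum>h\<in>?I. \<Sum>n=M..N. f (n + h))"
    by (intro norm_triangle_mono sum_norm_le sum_shift_diff_le assms order_refl)
  also have "(\<Sum>h\<in>?I. 2 * \<bar>real_of_int h\<bar>) \<le> H * (H / 2)"
    unfolding abs_sum by (simp add: H_def field_simps)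
  finally have "H * norm ?S \<le> H * (H / 2) + norm (\<Sum>h\<in>?I. \<Sum>n=M..N. f (n + h))"
    using H by (simp add: norm_mult)
  then show ?thesis using H by (simp add: field_simps)
qed

section \<open>Closed forms of the cosine and sine kernels\<close>

lemma two_sin_times_sum_cos:
  assumes "M \<le> N"
  shows "2 * sin x * (\<Sum>n=M..N. cos (2 * real_of_int n * x))
    = sin (real_of_int (2 * N + 1) * x) - sin (real_of_int (2 * M - 1) * x)"
proof -
  have telescope: "2 * (sin x * cos (2 * real_of_int n * x))
      = sin (real_of_int (2 * n + 1) * x) - sin (real_of_int (2 * n - 1) * x)" for n
  proof -
    have "x + 2 * real_of_int n * x = real_of_int (2 * n + 1) * x"
      and "x - 2 * real_of_int n * x = - (real_of_int (2 * n - 1) * x)"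
      by (simp_all add: algebra_simps)
    then show ?thesis by (simp only: sin_times_cos sin_minus) simp
  qed
  show ?thesis using assms
  proof (induction N rule: int_ge_induct)
    case base
    then show ?case using telescope[of M] by simp
  next
    case (step i)
    have "{M..i+1} = insert (i + 1) {M..i}" using step by auto
    moreover have "2 * (i + 1) - 1 = 2 * i + 1" by simp
    ultimately show ?case
      using step telescope[of "i + 1"] by (simp add: algebra_simps)
  qed
qed

text \<open>Telescoping leaves a difference of two cosines. Rewriting it as a product of two sines
  prepares the mean value 1/2 for odd characters.\<close>

lemma sin_times_sum_sin:
  assumes "M \<le> N"
  shows "sin x * (\<Sum>n=M..N. sin (2 * real_of_int n * x))
    = sin (real_of_int (M + N) * x) * sin (real_of_int (N - M + 1) * x)"
proof -
  have telescope: "2 * (sin x * sin (2 * real_of_int n * x))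
      = cos (real_of_int (2 * n - 1) * x) - cos (real_of_int (2 * n + 1) * x)" for n
  proof -
    have "x - 2 * real_of_int n * x = - (real_of_int (2 * n - 1) * x)"
      and "x + 2 * real_of_int n * x = real_of_int (2 * n + 1) * x"
      by (simp_all add: algebra_simps)
    then show ?thesis by (simp only: sin_times_sin cos_minus) simp
  qed
  have "2 * (sin x * (\<Sum>n=M..N. sin (2 * real_of_int n * x)))
    = cos (real_of_int (2 * M - 1) * x) - cos (real_of_int (2 * N + 1) * x)" using assms
  proof (induction N rule: int_ge_induct)
    case base
    then show ?case using telescope[of M] by simp
  next
    case (step i)
    have "{M..i+1} = insert (i + 1) {M..i}" using step by auto
    moreover have "2 * (i + 1) - 1 = 2 * i + 1" by simp
    ultimately show ?case
      using step telescope[of "i + 1"] by (simp add: algebra_simps)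
  qed
  also have "\<dots> = 2 * (sin (real_of_int (M + N) * x) * sin (real_of_int (N - M + 1) * x))"
  proof -
    have "(real_of_int (2 * M - 1) * x + real_of_int (2 * N + 1) * x) / 2 = real_of_int (M + N) * x"
      and "(real_of_int (2 * N + 1) * x - real_of_int (2 * M - 1) * x) / 2 = real_of_int (N - M + 1) * x"
      by (simp_all add: field_simps)
    then show ?thesis by (simp only: cos_diff_cos mult.assoc)
  qed
  finally show ?thesis by simp
qed

section \<open>Low and high frequencies in the weighted cosecant sum\<close>

lemma sum_inverse_squares_le:
  assumes "0 < L"
  shows "(\<Sum>a=Suc L..m. 1 / (real a)\<^sup>2) \<le> 1 / real L"
proof (cases "L \<le> m")
  case True
  then have "(\<Sum>a=Suc L..m. 1 / (real a)\<^sup>2) \<le> 1 / real L - 1 / real m"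
  proof (induction m rule: dec_induct)
    case (step m)
    have "1 / (real (Suc m))\<^sup>2 \<le> 1 / (real m * real (Suc m))"
      using step assms by (intro divide_left_mono) (auto simp: power2_eq_square intro!: mult_right_mono)
    also have "\<dots> = 1 / real m - 1 / real (Suc m)"
      using step assms by (simp add: field_simps)
    finally show ?case using step by simp
  qed simp
  also have "\<dots> \<le> 1 / real L" by simp
  finally show ?thesis .
qed simp

text \<open>Fold a and q - a together. For even q the middle index q / 2 is counted twice on the
  right, hence an inequality.\<close>

lemma sum_symmetric_le:
  fixes w :: "int \<Rightarrow> real"
  assumes "\<And>a. 0 < a \<Longrightarrow> a < int q \<Longrightarrow> 0 \<le> w a" "\<And>a. 0 < a \<Longrightarrow> a < int q \<Longrightarrow> w (int q - a) = w a"
  shows "(\<Sum>a\<in>{1..<int q}. w a) \<le> 2 * (\<Sum>a=1..q div 2. w (int a))"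
proof (cases "q \<le> 1")
  case True
  then show ?thesis by (cases "q = 0") (auto simp: le_Suc_eq)
next
  case False
  let ?A = "{1..int q div 2}"
  have A: "0 < a \<and> a < int q" if "a \<in> ?A" for a using that by auto
  have "(\<Sum>a\<in>{1..<int q}. w a) \<le> (\<Sum>a\<in>?A \<union> (\<lambda>a. int q - a) ` ?A. w a)"
  proof (rule sum_mono2)
    show "{1..<int q} \<subseteq> ?A \<union> (\<lambda>a. int q - a) ` ?A"
    proof
      fix a assume a: "a \<in> {1..<int q}"
      show "a \<in> ?A \<union> (\<lambda>a. int q - a) ` ?A"
      proof (cases "a \<le> int q div 2")
        case False
        then have "a = int q - (int q - a)" "int q - a \<in> ?A" using a by auto
        then show ?thesis by blast
      qed (use a in auto)
    qed
    show "0 \<le> w b" if "b \<in> (?A \<union> (\<lambda>a. int q - a) ` ?A) - {1..<int q}" for b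
      using that by auto
  qed simp
  also have "\<dots> \<le> (\<Sum>a\<in>?A. w a) + (\<Sum>a\<in>(\<lambda>a. int q - a) ` ?A. w a)"
  proof -
    have "0 \<le> (\<Sum>a\<in>?A \<inter> (\<lambda>a. int q - a) ` ?A. w a)"
      using A by (intro sum_nonneg assms(1)) auto
    then show ?thesis by (simp add: sum_Un)
  qed
  also have "(\<Sum>a\<in>(\<lambda>a. int q - a) ` ?A. w a) = (\<Sum>a\<in>?A. w (int q - a))"
    by (subst sum.reindex) (auto simp: inj_on_def)
  also have "\<dots> = (\<Sum>a\<in>?A. w a)" using A by (intro sum.cong refl assms(2)) auto
  also have "(\<Sum>a\<in>?A. w a) = (\<Sum>a=1..q div 2. w (int a))"
    by (rule sum.reindex_bij_witness[of _ int nat]) auto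
  finally show ?thesis by simp
qed

text \<open>The sum is split at L. Up to L the minimum is bounded by H and the remaining cosecant by
  1/y + y/3; beyond L the minimum is bounded by the cosecant, and Jordan's inequality leaves a tail
  of inverse squares.\<close>

lemma weighted_cosecant_sum_le:
  fixes k :: "nat \<Rightarrow> real" and L q :: nat and H B :: real
  assumes k: "\<And>a. 0 \<le> k a" "\<And>a. k a \<le> 1" and B: "(\<Sum>a=1..L. k a / real a) \<le> B"
    and L: "0 < L" "2 * L \<le> q" and H: "0 < H"
  shows "(\<Sum>a=1..q div 2. k a / sin (pi * real a / real q) * min H (1 / sin (pi * real a / real q)))
    \<le> H * (real q / pi * B + pi / (3 * real q) * (real L * (real L + 1) / 2)) + (real q)\<^sup>2 / (4 * real L)"
proof -
  define s where "s = (\<lambda>a. sin (pi * real a / real q))"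
  define w where "w = (\<lambda>a. k a / s a * min H (1 / s a))"
  have q: "0 < q" using L by simp
  have s: "0 < s a" "2 * real a / real q \<le> s a" "1 / s a \<le> real q / (pi * real a) + pi * real a / (3 * real q)"
    if "a \<in> {1..q div 2}" for a
  proof -
    have a: "0 < a" "2 * a \<le> q" using that by auto
    then have "2 * real a \<le> real q" by linarith
    then have x: "0 < pi * real a / real q" "pi * real a / real q \<le> pi / 2"
      using a q by (simp_all add: field_simps)
    moreover have "pi * real a / real q < pi" using x(2) pi_gt_zero by linarith
    ultimately show "0 < s a" unfolding s_def by (intro sin_gt_zero)
    show "2 * real a / real q \<le> s a"
      using Jordan_sin_ge[of "pi * real a / real q"] x by (simp add: s_def)
    show "1 / s a \<le> real q / (pi * real a) + pi * real a / (3 * real q)"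
      using inverse_sin_le[OF x] by (simp add: s_def mult.commute)
  qed
  have "{1..q div 2} = {1..L} \<union> {Suc L..q div 2}" using L by auto
  then have "(\<Sum>a=1..q div 2. w a) = (\<Sum>a=1..L. w a) + (\<Sum>a=Suc L..q div 2. w a)"
    by (simp add: sum.union_disjoint)
  also have "(\<Sum>a=1..L. w a) \<le> (\<Sum>a=1..L. H * (real q / pi * (k a / real a) + pi / (3 * real q) * real a))"
  proof (rule sum_mono)
    fix a assume "a \<in> {1..L}"
    then have a: "a \<in> {1..q div 2}" "0 < a" using L by auto
    have "w a \<le> k a / s a * H"
      unfolding w_def using k s(1)[OF a(1)] by (intro mult_left_mono) auto
    also have "\<dots> = H * (k a * (1 / s a))" by simp
    also have "\<dots> \<le> H * (k a * (real q / (pi * real a) + pi * real a / (3 * real q)))"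
      using H k s(3)[OF a(1)] by (intro mult_left_mono) auto
    also have "\<dots> = H * (real q / pi * (k a / real a) + k a * (pi * real a / (3 * real q)))"
      using a q by (simp add: field_simps)
    \<comment> \<open>Only the correction term gives up \<open>k a\<close>; the main term keeps it
      for the bound \<open>B\<close>.\<close>
    also have "\<dots> \<le> H * (real q / pi * (k a / real a) + 1 * (pi * real a / (3 * real q)))"
      using H k by (intro mult_left_mono add_left_mono mult_right_mono) auto
    finally show "w a \<le> H * (real q / pi * (k a / real a) + pi / (3 * real q) * real a)" by simp
  qed
  also have "\<dots> = H * (real q / pi * (\<Sum>a=1..L. k a / real a) + pi / (3 * real q) * (\<Sum>a=1..L. real a))"
    by (simp only: sum_distrib_left[symmetric] sum.distrib)
  also have "\<dots> \<le> H * (real q / pi * B + pi / (3 * real q) * (\<Sum>a=1..L. real a))"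
    using H B q by (intro mult_left_mono add_right_mono) auto
  also have "(\<Sum>a=1..L. real a) = real L * (real L + 1) / 2"
    by (induction L) (auto simp: field_simps)
  also have "(\<Sum>a=Suc L..q div 2. w a) \<le> (\<Sum>a=Suc L..q div 2. (real q)\<^sup>2 / 4 * (1 / (real a)\<^sup>2))"
  proof (rule sum_mono)
    fix a assume "a \<in> {Suc L..q div 2}"
    then have a: "a \<in> {1..q div 2}" "0 < a" by auto
    have "w a \<le> 1 / s a * (1 / s a)"
      unfolding w_def using k s(1)[OF a(1)] H by (intro mult_mono divide_right_mono) auto
    also have "\<dots> \<le> real q / (2 * real a) * (real q / (2 * real a))"
    proof -
      have "1 / s a \<le> 1 / (2 * real a / real q)"
        using s[OF a(1)] a q by (intro divide_left_mono) auto
      then show ?thesis using s(1)[OF a(1)] by (intro mult_mono) auto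
    qed
    finally show "w a \<le> (real q)\<^sup>2 / 4 * (1 / (real a)\<^sup>2)" by (simp add: power2_eq_square)
  qed
  also have "\<dots> \<le> (real q)\<^sup>2 / 4 * (1 / real L)"
    unfolding sum_distrib_left[symmetric] using L by (intro mult_left_mono sum_inverse_squares_le) auto
  finally show ?thesis by (simp add: w_def s_def)
qed

context primitive_char
begin

text \<open>
  The function \<open>g\<close> stands for the cosine or the sine, depending on the parity of the character, and
  \<open>k\<close> bounds the numerator of the kernel \<open>\<Sum>n. g (2 n x)\<close> at \<open>x = \<pi> a / q\<close>.
\<close>

lemma norm_char_sum_le:
  fixes g :: "real \<Rightarrow> real" and k :: "int \<Rightarrow> real" and u :: complex and K L :: nat and B :: real
  assumes q: "2 \<le> q" and MN: "M \<le> N"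
    and g: "\<And>v w. g (v + w) + g (v - w) = 2 * g v * cos w"
    and fourier: "\<And>n. gauss_sum n = u * (\<Sum>a\<in>{0..<int q}. chi a * of_real (g (2 * real_of_int n * (pi * real_of_int a / real q))))"
    and u: "norm u \<le> 1"
    and k: "\<And>a. 0 \<le> k a" "\<And>a. k a \<le> 1" "\<And>a. k (int q - a) = k a"
    and kernel: "\<And>a. \<bar>sin (pi * real_of_int a / real q) * (\<Sum>n=M..N. g (2 * real_of_int n * (pi * real_of_int a / real q)))\<bar> \<le> k a"
    and B: "(\<Sum>a=1..L. k (int a) / real a) \<le> B"
    and L: "0 < L" "2 * L \<le> q"
  defines "H \<equiv> 2 * real K + 1"
  shows "norm (\<Sum>n=M..N. chi n) \<le> H / 2 + 2 / sqrt (real q) *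
    (real q / pi * B + pi / (3 * real q) * (real L * (real L + 1) / 2) + (real q)\<^sup>2 / (4 * H * real L))"
proof -
  let ?I = "{- int K..int K}"
  define x where "x = (\<lambda>a::int. pi * real_of_int a / real q)"
  define w where "w = (\<lambda>a. k a / sin (x a) * min H (1 / sin (x a)))"
  \<comment> \<open>The conjugate character is averaged because separability represents its values
    by Gauss sums. Conjugation does not change the norm of the original sum.\<close>
  define A where "A = (\<Sum>h\<in>?I. \<Sum>n=M..N. cnj (chi (n + h)))"
  define R where "R = real q / pi * B + pi / (3 * real q) * (real L * (real L + 1) / 2)"
  define D where "D = (\<lambda>a. \<Sum>h\<in>?I. cos (2 * real_of_int h * x a))"
  define G where "G = (\<lambda>a. \<Sum>n=M..N. g (2 * real_of_int n * x a))"
  have H: "0 < H" by (simp add: H_def)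
  have sin_pos: "0 < sin (x a)" if "0 < a" "a < int q" for a
  proof (rule sin_gt_zero)
    show "x a < pi" using that q by (simp add: x_def field_simps)
  qed (use that q in \<open>simp add: x_def\<close>)
  \<comment> \<open>This removes the frequency 0, where the sine in the denominator
    vanishes.\<close>
  have chi0: "chi 0 = 0"
    using chi_nonzero_iff[of 0] q by auto
  \<comment> \<open>After the Gauss sums are expanded, each frequency a factors into the interval
    kernel \<open>G a\<close> and the averaging kernel \<open>D a\<close>.\<close>
  have "A * gauss_sum 1 = (\<Sum>h\<in>?I. \<Sum>n=M..N. gauss_sum (n + h))"
    by (simp only: A_def sum_distrib_right cnj_chi_gauss_sum)
  also have "\<dots> = (\<Sum>h\<in>?I. \<Sum>n=M..N. \<Sum>a\<in>{0..<int q}. u * (chi a * of_real (g (2 * real_of_int (n + h) * x a))))"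
    by (simp only: fourier sum_distrib_left x_def)
  also have "\<dots> = (\<Sum>h\<in>?I. \<Sum>a\<in>{0..<int q}. \<Sum>n=M..N. u * (chi a * of_real (g (2 * real_of_int (n + h) * x a))))"
    by (intro sum.cong refl sum.swap)
  also have "\<dots> = (\<Sum>a\<in>{0..<int q}. \<Sum>h\<in>?I. \<Sum>n=M..N. u * (chi a * of_real (g (2 * real_of_int (n + h) * x a))))"
    by (rule sum.swap)
  also have "\<dots> = (\<Sum>a\<in>{0..<int q}. u * (chi a * of_real (G a * D a)))"
  proof (intro sum.cong refl)
    fix a
    have "(\<Sum>h\<in>?I. \<Sum>n=M..N. g (2 * real_of_int (n + h) * x a))
        = (\<Sum>n=M..N. \<Sum>h\<in>?I. g (2 * real_of_int n * x a + 2 * real_of_int h * x a))"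
      by (subst sum.swap) (simp add: distrib_left distrib_right)
    also have "\<dots> = G a * D a"
      unfolding sum_symmetric_shift[OF g] G_def D_def sum_distrib_right ..
    finally show "(\<Sum>h\<in>?I. \<Sum>n=M..N. u * (chi a * of_real (g (2 * real_of_int (n + h) * x a))))
        = u * (chi a * of_real (G a * D a))"
      by (simp only: sum_distrib_left[symmetric] of_real_sum[symmetric])
  qed
  also have "norm \<dots> \<le> (\<Sum>a\<in>{0..<int q}. norm (u * (chi a * of_real (G a * D a))))"
    by (rule norm_sum)
  also have "\<dots> = (\<Sum>a\<in>{1..<int q}. norm (u * (chi a * of_real (G a * D a))))"
  proof -
    have "{0..<int q} = insert 0 {1..<int q}" using q by auto
    then show ?thesis by (simp add: chi0)
  qed
  also have "\<dots> \<le> (\<Sum>a\<in>{1..<int q}. w a)"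
  proof (rule sum_mono)
    fix a assume "a \<in> {1..<int q}"
    then have s: "0 < sin (x a)" using sin_pos by simp
    \<comment> \<open>Two bounds for \<open>D a\<close>, the closed form and the number H of
      translates, account for the minimum in \<open>w\<close>.\<close>
    have "\<bar>sin (x a)\<bar> * \<bar>D a\<bar> \<le> 1"
      using sin_times_Dirichlet_kernel[of "x a" K] by (simp add: D_def flip: abs_mult)
    then have D1: "\<bar>D a\<bar> \<le> 1 / sin (x a)" using s by (simp add: field_simps)
    have "\<bar>D a\<bar> \<le> (\<Sum>h\<in>?I. 1)" unfolding D_def by (intro sum_norm_le[of ?I, where f = "\<lambda>h. cos (2 * real_of_int h * x a)", simplified real_norm_def]) auto
    then have D2: "\<bar>D a\<bar> \<le> H" by (simp add: H_def)
    have "sin (x a) * \<bar>G a\<bar> \<le> k a" using kernel[of a] s by (simp add: G_def x_def abs_mult)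
    then have "\<bar>G a\<bar> \<le> k a / sin (x a)" using s by (simp add: field_simps)
    then have "\<bar>G a\<bar> * \<bar>D a\<bar> \<le> w a"
      unfolding w_def using D1 D2 k(1)[of a] s by (intro mult_mono) auto
    moreover have "norm (u * (chi a * of_real (G a * D a))) \<le> 1 * (1 * (\<bar>G a\<bar> * \<bar>D a\<bar>))"
      unfolding norm_mult norm_of_real abs_mult by (intro mult_mono u norm_chi_le_1) auto
    ultimately show "norm (u * (chi a * of_real (G a * D a))) \<le> w a" by simp
  qed
  also have "\<dots> \<le> 2 * (\<Sum>a=1..q div 2. w (int a))"
  proof (rule sum_symmetric_le)
    show "0 \<le> w a" if "0 < a" "a < int q" for a
      using sin_pos[OF that] k(1)[of a] H by (simp add: w_def)
    show "w (int q - a) = w a" if "0 < a" "a < int q" for a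
    proof -
      have "x (int q - a) = pi - x a" using q by (simp add: x_def field_simps)
      then show ?thesis by (simp add: w_def k)
    qed
  qed
  also have "\<dots> \<le> 2 * (H * R + (real q)\<^sup>2 / (4 * real L))"
    using weighted_cosecant_sum_le[OF k(1,2) B L H] by (simp add: w_def x_def R_def)
  finally have "norm A * sqrt (real q) \<le> 2 * (H * R + (real q)\<^sup>2 / (4 * real L))"
    by (simp add: norm_mult norm_gauss_sum)
  then have "norm A / H \<le> 2 / sqrt (real q) * (R + (real q)\<^sup>2 / (4 * H * real L))"
    using q H L by (simp add: field_simps)
  moreover have "norm (\<Sum>n=M..N. cnj (chi n)) \<le> H / 2 + norm A / H"
    unfolding H_def A_def using norm_chi_le_1 MN by (intro norm_sum_le_average) auto
  moreover have "norm (\<Sum>n=M..N. cnj (chi n)) = norm (\<Sum>n=M..N. chi n)"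
    by (metis cnj_sum complex_mod_cnj)
  ultimately show ?thesis by (simp add: R_def)
qed

end

section \<open>Parameters and numerical constants\<close>

text \<open>With L and H = 2K + 1 both close to r = sqrt q, the averaging loss H / 2 and the
  high-frequency tail each cost about r / 2. The factor \<beta> stands for the mean value, 2 / pi or
  1 / 2. From r >= 4 comes 2 (r + 1) <= r^2, hence the condition on L.\<close>

lemma obtain_smoothing_parameters:
  fixes q :: nat and \<beta> :: real
  assumes q: "16 \<le> q" and \<beta>: "0 \<le> \<beta>"
  defines "r \<equiv> sqrt (real q)"
  obtains K L :: nat where "0 < L" "2 * L \<le> q"
    "(2 * real K + 1) / 2 + 2 / sqrt (real q) *
      (real q / pi * (\<beta> * ((\<Sum>a=1..L. 1 / real a) + ln 2 + 2 / real L))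
        + pi / (3 * real q) * (real L * (real L + 1) / 2) + (real q)\<^sup>2 / (4 * (2 * real K + 1) * real L))
     \<le> r + 1 + 2 * r / pi * (\<beta> * (ln (real q) / 2 + euler_mascheroni + ln 2)) + 8 * \<beta> / pi
        + pi * (r + 1) * (r + 2) / (3 * r ^ 3)"
proof -
  have "sqrt 16 \<le> r" unfolding r_def using q by (subst real_sqrt_le_iff) simp
  then have r: "4 \<le> r" by simp
  have rr: "real q = r\<^sup>2" by (simp add: r_def)
  define L where "L = nat \<lceil>r\<rceil>"
  define K where "K = nat \<lceil>(r - 1) / 2\<rceil>"
  define H where "H = 2 * real K + 1"
  have L: "r \<le> real L" "real L \<le> r + 1" using r by (simp_all add: L_def)
  have "(r - 1) / 2 \<le> real K" "real K \<le> (r - 1) / 2 + 1"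
    using r by (simp_all add: K_def)
  then have H: "r \<le> H" "H \<le> r + 2" by (simp_all add: H_def field_simps)
  have "2 * (r + 1) \<le> r * r"
  proof -
    have "4 * r \<le> r * r" using r by (intro mult_right_mono) auto
    then show ?thesis using r by argo
  qed
  then have "2 * real L \<le> real q" using L rr by (simp add: power2_eq_square)
  then have L2: "2 * L \<le> q" by linarith
  have L0: "0 < L" using L r by linarith
  define E where "E = (\<Sum>a=1..L. 1 / real a) + ln 2 + 2 / real L"
  have lnr: "ln (real q) / 2 = ln r" using r by (simp add: rr ln_realpow)
  have "(\<Sum>a=1..L. 1 / real a) \<le> ln (real L + 1) + euler_mascheroni"
    by (rule harmonic_sum_le[OF L0])
  also have "ln (real L + 1) \<le> ln (r + 2)" using L r by (subst ln_le_cancel_iff) auto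
  also have "\<dots> \<le> ln r + 2 / r" using r by (intro ln_add_le) auto
  finally have "(\<Sum>a=1..L. 1 / real a) \<le> ln r + 2 / r + euler_mascheroni" by simp
  moreover have "2 / real L \<le> 2 / r" using L r by (intro divide_left_mono) auto
  moreover have "4 / r = 2 / r + 2 / r" by simp
  \<comment> \<open>One half of 4 / r comes from replacing ln (L + 1) by ln r, the other from 2 / L.
    Multiplied by 2 r \<beta> / pi it becomes the constant 8 \<beta> / pi.\<close>
  ultimately have E: "E \<le> ln (real q) / 2 + euler_mascheroni + ln 2 + 4 / r"
    unfolding E_def lnr by linarith
  have "2 / r * (real q / pi * (\<beta> * E)) = 2 * r / pi * (\<beta> * E)"
    using r by (simp add: rr power2_eq_square)
  also have "\<dots> \<le> 2 * r / pi * (\<beta> * (ln (real q) / 2 + euler_mascheroni + ln 2 + 4 / r))"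
    using E \<beta> r by (intro mult_left_mono) auto
  also have "\<dots> = 2 * r / pi * (\<beta> * (ln (real q) / 2 + euler_mascheroni + ln 2)) + 8 * \<beta> / pi"
    using r by (simp add: field_simps)
  finally have t1: "2 / r * (real q / pi * (\<beta> * E))
      \<le> 2 * r / pi * (\<beta> * (ln (real q) / 2 + euler_mascheroni + ln 2)) + 8 * \<beta> / pi" .
  have "real L * (real L + 1) \<le> (r + 1) * (r + 2)" using L r by (intro mult_mono) auto
  then have "2 / r * (pi / (3 * real q) * (real L * (real L + 1) / 2))
      \<le> 2 / r * (pi / (3 * real q) * ((r + 1) * (r + 2) / 2))"
    using r by (intro mult_left_mono divide_right_mono) auto
  also have "\<dots> = pi * (r + 1) * (r + 2) / (3 * r ^ 3)"
    using r by (simp add: rr power2_eq_square power3_eq_cube)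
  finally have t2: "2 / r * (pi / (3 * real q) * (real L * (real L + 1) / 2))
      \<le> pi * (r + 1) * (r + 2) / (3 * r ^ 3)" .
  have "r * r \<le> H * real L" using H L r by (intro mult_mono) auto
  then have "(real q)\<^sup>2 / (4 * H * real L) \<le> (real q)\<^sup>2 / (4 * (r * r))"
    using r H L by (intro divide_left_mono) auto
  then have "2 / r * ((real q)\<^sup>2 / (4 * H * real L)) \<le> 2 / r * ((real q)\<^sup>2 / (4 * (r * r)))"
    using r by (intro mult_left_mono) auto
  also have "\<dots> = r / 2" using r by (simp add: rr power2_eq_square)
  finally have t3: "2 / r * ((real q)\<^sup>2 / (4 * H * real L)) \<le> r / 2" .
  have "H / 2 + 2 / r * (real q / pi * (\<beta> * E) + pi / (3 * real q) * (real L * (real L + 1) / 2) + (real q)\<^sup>2 / (4 * H * real L))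
      \<le> r + 1 + 2 * r / pi * (\<beta> * (ln (real q) / 2 + euler_mascheroni + ln 2)) + 8 * \<beta> / pi
        + pi * (r + 1) * (r + 2) / (3 * r ^ 3)"
    using t1 t2 t3 H unfolding distrib_left by linarith
  then show ?thesis
    using that[OF L0 L2, of K] unfolding H_def E_def r_def by blast
qed

section \<open>Numerical comparison with the stated bounds\<close>

lemma C0_ge: "74 \<le> C\<^sub>0"
proof -
  have "(177 / 100)\<^sup>2 \<le> pi" using pi_approx by (simp add: power2_eq_square)
  then have "177 / 100 \<le> sqrt pi" by (rule real_le_rsqrt)
  moreover have "(314 / 100)\<^sup>2 \<le> pi\<^sup>2" using pi_approx by (intro power_mono) auto
  ultimately have "(314 / 100)\<^sup>2 * (177 / 100) \<le> pi\<^sup>2 * sqrt pi" by (intro mult_mono) auto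
  also have "\<dots> = pi powr (2 + 1 / 2)"
    unfolding powr_add by (simp add: powr_half_sqrt)
  finally show ?thesis by (simp add: C\<^sub>0_def power2_eq_square)
qed

text \<open>It suffices that e^3.1 <= 74 / 3.2, which follows from e < 2.72 and a quadratic bound
  for exp (1/10).\<close>

lemma ln_C0_div_pi_ge: "31 / 10 \<le> ln (C\<^sub>0 / pi)"
proof -
  have "exp (31 / 10 :: real) = exp 1 ^ 3 * exp (1 / 10)"
    by (simp flip: exp_of_nat_mult exp_add)
  also have "\<dots> \<le> (272 / 100) ^ 3 * (1 + 1 / 10 + (1 / 10)\<^sup>2)"
    using e_less_272 by (intro mult_mono power_mono exp_bound) auto
  also have "\<dots> \<le> 74 / (32 / 10)" by (simp add: power2_eq_square power3_eq_cube)
  also have "\<dots> \<le> C\<^sub>0 / pi" using C0_ge pi_approx by (intro frac_le) auto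
  finally show ?thesis using C0_ge by (subst ln_ge_iff) auto
qed

text \<open>For 0 < y <= 1/2 one has exp y - 1 <= y + y^2 <= 3 y / 2. For moderate q this makes the
  last terms of \<open>\<psi>\<^sub>1\<close> and \<open>\<psi>\<^sub>2\<close> as large as a
  constant multiple of \<open>C\<^sub>0\<close>.\<close>

lemma div_exp_minus_1_ge:
  fixes r c :: real
  assumes "0 < r" "0 < c" "c * r \<le> 1 / 2"
  shows "2 / (3 * c) \<le> r / (exp (c * r) - 1)"
proof -
  have y: "0 < c * r" using assms by simp
  have "exp (c * r) \<le> 1 + c * r + (c * r)\<^sup>2"
    using y assms(3) by (intro exp_bound) auto
  also have "(c * r)\<^sup>2 \<le> 1 / 2 * (c * r)"
    unfolding power2_eq_square using y assms(3) by (intro mult_right_mono) auto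
  finally have "exp (c * r) - 1 \<le> 3 / 2 * (c * r)" by simp
  moreover have "0 < exp (c * r) - 1" using y by simp
  ultimately have "r / (3 / 2 * (c * r)) \<le> r / (exp (c * r) - 1)"
    using assms by (intro divide_left_mono) auto
  then show ?thesis using assms by (simp add: mult_ac)
qed

text \<open>For q <= 36 the exponent is at most 12 / 74 < 1/2, so the quotient is at least
  \<open>C\<^sub>0 / 3 >= 24\<close>. The value 17 is large enough to dominate the trivial bound q +
  1 for q < 16.\<close>

lemma psi1_ge:
  shows "1 \<le> \<psi>\<^sub>1 q" and "0 < q \<Longrightarrow> q \<le> 36 \<Longrightarrow> 17 \<le> \<psi>\<^sub>1 q"
proof -
  let ?t = "8 / pi\<^sup>2 * (sqrt (real q) / (exp (2 * sqrt (real q) / C\<^sub>0) - 1))"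
  have C: "0 < C\<^sub>0" "74 \<le> C\<^sub>0" using C0_ge by linarith+
  have c: "0 \<le> 24 / (pi\<^sup>2 * C\<^sub>0)" using C by simp
  moreover have "0 \<le> ?t" using C by (intro mult_nonneg_nonneg divide_nonneg_nonneg) auto
  ultimately show "1 \<le> \<psi>\<^sub>1 q" unfolding \<psi>\<^sub>1_def by linarith
  assume q: "0 < q" "q \<le> 36"
  have "sqrt (real q) \<le> sqrt (6\<^sup>2)" using q by (subst real_sqrt_le_iff) simp
  then have r: "sqrt (real q) \<le> 6" by simp
  have "2 / (3 * (2 / C\<^sub>0)) \<le> sqrt (real q) / (exp (2 / C\<^sub>0 * sqrt (real q)) - 1)"
    using C r q by (intro div_exp_minus_1_ge) (auto simp: field_simps)
  also have "2 / C\<^sub>0 * sqrt (real q) = 2 * sqrt (real q) / C\<^sub>0" by simp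
  finally have "2 / (3 * (2 / C\<^sub>0)) \<le> sqrt (real q) / (exp (2 * sqrt (real q) / C\<^sub>0) - 1)" .
  moreover have "24 \<le> 2 / (3 * (2 / C\<^sub>0))" using C by simp
  ultimately have "24 \<le> sqrt (real q) / (exp (2 * sqrt (real q) / C\<^sub>0) - 1)" by linarith
  moreover have "3 / 4 \<le> 8 / pi\<^sup>2"
  proof -
    have "pi\<^sup>2 \<le> (32 / 10)\<^sup>2" using pi_approx by (intro power_mono) auto
    then show ?thesis by (simp add: field_simps power2_eq_square)
  qed
  ultimately have "3 / 4 * 24 \<le> ?t" by (intro mult_mono) auto
  with c show "17 \<le> \<psi>\<^sub>1 q" unfolding \<psi>\<^sub>1_def by linarith
qed

text \<open>The same argument gives a quotient of at least 15 and a factor 2 / pi >= 3/5. The value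
  10 serves both q < 16 and the range 4 <= sqrt q < 6.\<close>

lemma psi2_ge:
  shows "1 \<le> \<psi>\<^sub>2 q" and "0 < q \<Longrightarrow> q \<le> 36 \<Longrightarrow> 10 \<le> \<psi>\<^sub>2 q"
proof -
  let ?t = "2 / pi * (sqrt (real q) / (exp (pi * sqrt (real q) / C\<^sub>0) - 1))"
  have C: "0 < C\<^sub>0" "74 \<le> C\<^sub>0" using C0_ge by linarith+
  have c: "0 \<le> 3 / C\<^sub>0" using C by simp
  moreover have "0 \<le> ?t" using C by (intro mult_nonneg_nonneg divide_nonneg_nonneg) auto
  ultimately show "1 \<le> \<psi>\<^sub>2 q" unfolding \<psi>\<^sub>2_def by linarith
  assume q: "0 < q" "q \<le> 36"
  have "sqrt (real q) \<le> sqrt (6\<^sup>2)" using q by (subst real_sqrt_le_iff) simp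
  then have r: "sqrt (real q) \<le> 6" by simp
  have "pi * sqrt (real q) \<le> 32 / 10 * 6" using r pi_approx by (intro mult_mono) auto
  then have "2 / (3 * (pi / C\<^sub>0)) \<le> sqrt (real q) / (exp (pi / C\<^sub>0 * sqrt (real q)) - 1)"
    using C q by (intro div_exp_minus_1_ge) (auto simp: field_simps)
  moreover have "2 * 74 / (3 * (32 / 10)) \<le> 2 * C\<^sub>0 / (3 * pi)"
    using C pi_approx by (intro frac_le) auto
  ultimately have "15 \<le> sqrt (real q) / (exp (pi * sqrt (real q) / C\<^sub>0) - 1)" by simp
  moreover have "3 / 5 \<le> 2 / pi" using pi_approx by (simp add: field_simps)
  ultimately have "3 / 5 * 15 \<le> ?t" by (intro mult_mono) auto
  with c show "10 \<le> \<psi>\<^sub>2 q" unfolding \<psi>\<^sub>2_def by linarith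
qed

text \<open>Expanded, the term is pi / 3 times a sum of negative powers of r, so it decreases in r;
  moreover pi <= 16/5.\<close>

lemma correction_term_le:
  fixes r a :: real
  assumes "0 < a" "a \<le> r"
  shows "pi * (r + 1) * (r + 2) / (3 * r ^ 3) \<le> 16 / 15 * (1 / a + 3 / a\<^sup>2 + 2 / a ^ 3)"
proof -
  have "pi * (r + 1) * (r + 2) / (3 * r ^ 3) = pi / 3 * (1 / r + 3 / r\<^sup>2 + 2 / r ^ 3)"
    using assms by (simp add: field_simps power2_eq_square power3_eq_cube)
  also have "\<dots> \<le> 16 / 15 * (1 / a + 3 / a\<^sup>2 + 2 / a ^ 3)"
    using assms pi_approx by (intro mult_mono add_mono divide_left_mono power_mono) auto
  finally show ?thesis .
qed

text \<open>The terms in ln q and \<gamma> agree on both sides. What remains on the right is linear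
  in r with slope above 1.65, and for r >= 4 its excess over r covers 16 / pi^2 and the correction
  1/2; the summand 1 is covered by \<open>\<psi>\<^sub>1\<close>.\<close>

lemma even_bound_le:
  fixes q :: nat
  assumes "16 \<le> q"
  defines "r \<equiv> sqrt (real q)"
  shows "r + 1 + 2 * r / pi * (2 / pi * (ln (real q) / 2 + euler_mascheroni + ln 2)) + 8 * (2 / pi) / pi
        + pi * (r + 1) * (r + 2) / (3 * r ^ 3)
    \<le> 2 / pi\<^sup>2 * r * ln (real q) + 4 / pi\<^sup>2 * r * (1 + euler_mascheroni + ln C\<^sub>0) + \<psi>\<^sub>1 q"
proof -
  have "sqrt 16 \<le> r" unfolding r_def using assms(1) by (subst real_sqrt_le_iff) simp
  then have r: "4 \<le> r" by simp
  have C: "0 < C\<^sub>0" using C0_ge by simp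
  have pi2: "98 / 10 \<le> pi\<^sup>2" "pi\<^sup>2 \<le> 99 / 10"
  proof -
    have "(3141 / 1000)\<^sup>2 \<le> pi\<^sup>2" "pi\<^sup>2 \<le> (3142 / 1000)\<^sup>2" using pi_approx by (auto intro!: power_mono)
    then show "98 / 10 \<le> pi\<^sup>2" "pi\<^sup>2 \<le> 99 / 10" by (simp_all add: power2_eq_square)
  qed
  have "C\<^sub>0 / pi \<le> C\<^sub>0 / 2" using C pi_gt3 by (intro divide_left_mono) auto
  then have "ln (C\<^sub>0 / pi) \<le> ln (C\<^sub>0 / 2)" using C by simp
  moreover have "ln (C\<^sub>0 / 2) = ln C\<^sub>0 - ln 2" using C by (simp add: ln_div)
  ultimately have "31 / 10 \<le> ln C\<^sub>0 - ln 2" using ln_C0_div_pi_ge by linarith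
  moreover have "40 / 99 \<le> 4 / pi\<^sup>2" using pi2 by (simp add: field_simps)
  ultimately have "40 / 99 * (41 / 10) \<le> 4 / pi\<^sup>2 * (1 + ln C\<^sub>0 - ln 2)"
    by (intro mult_mono) auto
  then have "(40 / 99 * (41 / 10)) * r \<le> (4 / pi\<^sup>2 * (1 + ln C\<^sub>0 - ln 2)) * r"
    using r by (intro mult_right_mono) auto
  moreover have "16 / pi\<^sup>2 \<le> 16 / (98 / 10)" using pi2 by (intro divide_left_mono) auto
  moreover have "pi * (r + 1) * (r + 2) / (3 * r ^ 3) \<le> 1 / 2"
    using correction_term_le[of 4 r] r by (simp add: power2_eq_square power3_eq_cube)
  ultimately have "r + 16 / pi\<^sup>2 + pi * (r + 1) * (r + 2) / (3 * r ^ 3) \<le> 4 / pi\<^sup>2 * (1 + ln C\<^sub>0 - ln 2) * r"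
    using r by argo
  moreover have "2 * r / pi * (2 / pi * (ln (real q) / 2 + euler_mascheroni + ln 2)) + 4 / pi\<^sup>2 * (1 + ln C\<^sub>0 - ln 2) * r
      = 2 / pi\<^sup>2 * r * ln (real q) + 4 / pi\<^sup>2 * r * (1 + euler_mascheroni + ln C\<^sub>0)"
    by (simp add: field_simps power2_eq_square)
  moreover have "8 * (2 / pi) / pi = 16 / pi\<^sup>2" by (simp add: power2_eq_square)
  ultimately show ?thesis using psi1_ge(1)[of q] by linarith
qed

text \<open>Here the slope left over is only about 1.30. Its excess over r suffices with
  \<open>\<psi>\<^sub>2 >= 1\<close> once r >= 6; for 4 <= r < 6 the stronger bound
  \<open>\<psi>\<^sub>2 >= 10\<close> is used.\<close>

lemma odd_bound_le:
  fixes q :: nat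
  assumes "16 \<le> q"
  defines "r \<equiv> sqrt (real q)"
  shows "r + 1 + 2 * r / pi * (1 / 2 * (ln (real q) / 2 + euler_mascheroni + ln 2)) + 8 * (1 / 2) / pi
        + pi * (r + 1) * (r + 2) / (3 * r ^ 3)
    \<le> 1 / (2 * pi) * r * ln (real q) + 1 / pi * r * (1 + euler_mascheroni + ln (2 * C\<^sub>0 / pi)) + \<psi>\<^sub>2 q"
proof -
  have "sqrt 16 \<le> r" unfolding r_def using assms(1) by (subst real_sqrt_le_iff) simp
  then have r: "4 \<le> r" by simp
  have C: "0 < C\<^sub>0" using C0_ge by simp
  have "100 / 315 \<le> 1 / pi" using pi_approx by (simp add: field_simps)
  with ln_C0_div_pi_ge have "100 / 315 * (41 / 10) \<le> 1 / pi * (1 + ln (C\<^sub>0 / pi))"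
    by (intro mult_mono) auto
  then have "(100 / 315 * (41 / 10)) * r \<le> (1 / pi * (1 + ln (C\<^sub>0 / pi))) * r"
    using r by (intro mult_right_mono) auto
  moreover have "4 / pi \<le> 13 / 10" using pi_approx by (simp add: field_simps)
  \<comment> \<open>The constant 23/10 is the summand 1 plus the bound 13/10 for 4 / pi.\<close>
  moreover have "r + pi * (r + 1) * (r + 2) / (3 * r ^ 3) + 23 / 10 \<le> 100 / 315 * (41 / 10) * r + \<psi>\<^sub>2 q"
  proof (cases "6 \<le> r")
    case True
    then have "pi * (r + 1) * (r + 2) / (3 * r ^ 3) \<le> 3 / 10"
      using correction_term_le[of 6 r] by (simp add: power2_eq_square power3_eq_cube)
    with True psi2_ge(1)[of q] show ?thesis by linarith
  next
    case False
    have "pi * (r + 1) * (r + 2) / (3 * r ^ 3) \<le> 1 / 2"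
      using correction_term_le[of 4 r] r by (simp add: power2_eq_square power3_eq_cube)
    moreover have "r\<^sup>2 < 6\<^sup>2" using False r by (intro power_strict_mono) auto
    then have "q \<le> 36" by (simp add: r_def)
    ultimately show ?thesis using psi2_ge(2)[of q] assms r by linarith
  qed
  ultimately have "r + 1 + 4 / pi + pi * (r + 1) * (r + 2) / (3 * r ^ 3) \<le> 1 / pi * (1 + ln (C\<^sub>0 / pi)) * r + \<psi>\<^sub>2 q"
    by argo
  moreover have "ln (2 * C\<^sub>0 / pi) = ln 2 + ln (C\<^sub>0 / pi)"
    using C ln_mult_pos[of 2 "C\<^sub>0 / pi"] by simp
  then have "2 * r / pi * (1 / 2 * (ln (real q) / 2 + euler_mascheroni + ln 2)) + 1 / pi * (1 + ln (C\<^sub>0 / pi)) * r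
      = 1 / (2 * pi) * r * ln (real q) + 1 / pi * r * (1 + euler_mascheroni + ln (2 * C\<^sub>0 / pi))"
    by (simp add: field_simps)
  moreover have "8 * (1 / 2) / pi = 4 / pi" by simp
  ultimately show ?thesis by linarith
qed

section \<open>Even and odd characters\<close>

lemma abs_sin_reflect:
  fixes m a :: int
  assumes "0 < q"
  shows "\<bar>sin (pi * real_of_int ((int q - a) * m) / real q)\<bar> = \<bar>sin (pi * real_of_int (a * m) / real q)\<bar>"
proof -
  have "pi * real_of_int ((int q - a) * m) / real q = pi * real_of_int m - pi * real_of_int (a * m) / real q"
    using assms by (simp add: field_simps)
  moreover have "\<bar>cos (pi * real_of_int m)\<bar> = 1" by (simp add: cos_npi_int)
  ultimately show ?thesis by (simp add: sin_diff sin_npi_int abs_mult)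
qed

text \<open>The inequality |sin u sin v| <= (sin^2 u + sin^2 v) / 2 has constant part 1/2 and two
  cosines of weight -1/4, to which the uniform lower bound for cosine sums applies.\<close>

lemma sum_abs_sin_times_sin_div_le:
  fixes x y :: real
  assumes "0 < L"
  shows "(\<Sum>a=1..L. \<bar>sin (real a * x) * sin (real a * y)\<bar> / real a)
    \<le> 1 / 2 * ((\<Sum>a=1..L. 1 / real a) + ln 2 + 2 / real L)"
proof -
  have "\<bar>sin u * sin v\<bar> \<le> 1 / 2 - cos (2 * u) / 4 - cos (2 * v) / 4" for u v :: real
  proof -
    have "0 \<le> (\<bar>sin u\<bar> - \<bar>sin v\<bar>)\<^sup>2" by simp
    then have "2 * (\<bar>sin u\<bar> * \<bar>sin v\<bar>) \<le> (sin u)\<^sup>2 + (sin v)\<^sup>2"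
      by (simp add: power2_diff)
    then show ?thesis by (simp add: cos_double_sin abs_mult diff_divide_distrib)
  qed
  then have "(\<Sum>a=1..L. \<bar>sin (real a * x) * sin (real a * y)\<bar> / real a)
      \<le> (\<Sum>a=1..L. (1 / 2 - cos (2 * (real a * x)) / 4 - cos (2 * (real a * y)) / 4) / real a)"
    by (intro sum_mono divide_right_mono) auto
  also have "\<dots> = (\<Sum>a=1..L. 1 / 2 * (1 / real a) - 1 / 4 * (cos (real a * (2 * x)) / real a)
      - 1 / 4 * (cos (real a * (2 * y)) / real a))"
    by (intro sum.cong refl) (simp add: diff_divide_distrib mult.left_commute)
  also have "\<dots> = 1 / 2 * (\<Sum>a=1..L. 1 / real a) - 1 / 4 * (\<Sum>a=1..L. cos (real a * (2 * x)) / real a)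
      - 1 / 4 * (\<Sum>a=1..L. cos (real a * (2 * y)) / real a)"
    by (simp only: sum_subtractf sum_distrib_left)
  also have "\<dots> \<le> 1 / 2 * ((\<Sum>a=1..L. 1 / real a) + ln 2 + 2 / real L)"
    using sum_cos_div_ge[OF assms, of "2 * x"] sum_cos_div_ge[OF assms, of "2 * y"]
    by (simp add: distrib_left)
  finally show ?thesis .
qed

context primitive_char
begin

text \<open>Add to the Gauss sum its reflected form under a -> -a.\<close>

lemma twice_gauss_sum:
  "2 * gauss_sum n = (\<Sum>a\<in>{0..<int q}. chi a * (add_char q (a * n) + chi (- 1) * cnj (add_char q (a * n))))"
proof -
  have "gauss_sum n = (\<Sum>a\<in>{0..<int q}. chi ((- 1) * a + 0) * add_char q (((- 1) * a + 0) * n))"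
    unfolding gauss_sum_def using modulus_pos gauss_term_periodic
    by (intro sum_residues_affine[of "int q" "\<lambda>a. chi a * add_char q (a * n)" "- 1" 0, THEN sym]) simp_all
  also have "\<dots> = (\<Sum>a\<in>{0..<int q}. chi a * (chi (- 1) * cnj (add_char q (a * n))))"
  proof (intro sum.cong refl)
    fix a
    have "chi (- a) = chi (- 1) * chi a" using chi_mult[of "- 1" a] by simp
    then show "chi ((- 1) * a + 0) * add_char q (((- 1) * a + 0) * n) = chi a * (chi (- 1) * cnj (add_char q (a * n)))"
      by (simp add: cnj_add_char)
  qed
  finally have "gauss_sum n + gauss_sum n = (\<Sum>a\<in>{0..<int q}. chi a * add_char q (a * n))
      + (\<Sum>a\<in>{0..<int q}. chi a * (chi (- 1) * cnj (add_char q (a * n))))"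
    by (simp only: gauss_sum_def)
  then show ?thesis by (simp only: mult_2 distrib_left sum.distrib)
qed

text \<open>The factor 1 is the unimodular constant \<open>u\<close> of the general estimate; for
  odd characters it is the imaginary unit.\<close>

lemma gauss_sum_even:
  assumes "chi (- 1) = 1"
  shows "gauss_sum n = 1 * (\<Sum>a\<in>{0..<int q}. chi a * of_real (cos (2 * real_of_int n * (pi * real_of_int a / real q))))"
proof -
  have "add_char q (a * n) + chi (- 1) * cnj (add_char q (a * n))
      = 2 * of_real (cos (2 * real_of_int n * (pi * real_of_int a / real q)))" for a
    by (simp add: assms complex_eq_iff add_char_def mult_ac)
  then have "2 * gauss_sum n = 2 * (\<Sum>a\<in>{0..<int q}. chi a * of_real (cos (2 * real_of_int n * (pi * real_of_int a / real q))))"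
    unfolding twice_gauss_sum sum_distrib_left by (intro sum.cong refl) simp
  then show ?thesis by simp
qed

lemma gauss_sum_odd:
  assumes "chi (- 1) = - 1"
  shows "gauss_sum n = \<i> * (\<Sum>a\<in>{0..<int q}. chi a * of_real (sin (2 * real_of_int n * (pi * real_of_int a / real q))))"
proof -
  have "add_char q (a * n) + chi (- 1) * cnj (add_char q (a * n))
      = 2 * (\<i> * of_real (sin (2 * real_of_int n * (pi * real_of_int a / real q))))" for a
    by (simp add: assms complex_eq_iff add_char_def mult_ac)
  then have "2 * gauss_sum n = 2 * (\<i> * (\<Sum>a\<in>{0..<int q}. chi a * of_real (sin (2 * real_of_int n * (pi * real_of_int a / real q)))))"
    unfolding twice_gauss_sum sum_distrib_left by (intro sum.cong refl) simp
  then show ?thesis by simp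
qed

lemma even_char_sum_le:
  assumes even: "chi (- 1) = 1" and q: "16 \<le> q" and MN: "M \<le> N"
  shows "norm (\<Sum>n=M..N. chi n)
    \<le> 2 / pi\<^sup>2 * sqrt (real q) * ln (real q)
      + 4 / pi\<^sup>2 * sqrt (real q) * (1 + euler_mascheroni + ln C\<^sub>0) + \<psi>\<^sub>1 q"
proof -
  define s where "s = (\<lambda>m a :: int. \<bar>sin (pi * real_of_int (a * m) / real q)\<bar>)"
  \<comment> \<open>The kernel numerator is half a difference of two sines, so the average of their
    absolute values bounds it. Each of the two sums has the constant 2 / pi.\<close>
  define k where "k = (\<lambda>a. (s (2 * N + 1) a + s (2 * M - 1) a) / 2)"
  have s: "0 \<le> s m a" "s m a \<le> 1" for m a by (simp_all add: s_def)
  obtain K L where L: "0 < L" "2 * L \<le> q" and bound: "(2 * real K + 1) / 2 + 2 / sqrt (real q) *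
      (real q / pi * (2 / pi * ((\<Sum>a=1..L. 1 / real a) + ln 2 + 2 / real L))
        + pi / (3 * real q) * (real L * (real L + 1) / 2) + (real q)\<^sup>2 / (4 * (2 * real K + 1) * real L))
     \<le> sqrt (real q) + 1 + 2 * sqrt (real q) / pi * (2 / pi * (ln (real q) / 2 + euler_mascheroni + ln 2))
        + 8 * (2 / pi) / pi + pi * (sqrt (real q) + 1) * (sqrt (real q) + 2) / (3 * sqrt (real q) ^ 3)"
    by (rule obtain_smoothing_parameters[OF q, of "2 / pi"]) (simp, assumption)
  have s_sum: "(\<Sum>a=1..L. s m (int a) / real a) \<le> 2 / pi * ((\<Sum>a=1..L. 1 / real a) + ln 2 + 2 / real L)" for m
    unfolding s_def using q L by (intro sum_abs_sin_div_le) auto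
  have "norm (\<Sum>n=M..N. chi n) \<le> (2 * real K + 1) / 2 + 2 / sqrt (real q) *
      (real q / pi * (2 / pi * ((\<Sum>a=1..L. 1 / real a) + ln 2 + 2 / real L))
        + pi / (3 * real q) * (real L * (real L + 1) / 2) + (real q)\<^sup>2 / (4 * (2 * real K + 1) * real L))"
  proof (rule norm_char_sum_le[where g = cos and u = 1 and k = k])
    show "cos (v + w) + cos (v - w) = 2 * cos v * cos w" for v w :: real
      by (simp add: cos_add cos_diff)
    show "gauss_sum n = 1 * (\<Sum>a\<in>{0..<int q}. chi a * of_real (cos (2 * real_of_int n * (pi * real_of_int a / real q))))" for n
      by (rule gauss_sum_even[OF even])
    show "0 \<le> k a" "k a \<le> 1" for a
      using s[of "2 * N + 1" a] s[of "2 * M - 1" a] by (simp_all add: k_def)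
    show "k (int q - a) = k a" for a
      using q by (simp only: k_def s_def abs_sin_reflect)
    show "\<bar>sin (pi * real_of_int a / real q) * (\<Sum>n=M..N. cos (2 * real_of_int n * (pi * real_of_int a / real q)))\<bar> \<le> k a" for a
    proof -
      define x where "x = pi * real_of_int a / real q"
      have x: "s m a = \<bar>sin (real_of_int m * x)\<bar>" for m
        by (simp add: s_def x_def mult_ac)
      have "2 * (sin x * (\<Sum>n=M..N. cos (2 * real_of_int n * x)))
          = sin (real_of_int (2 * N + 1) * x) - sin (real_of_int (2 * M - 1) * x)"
        using two_sin_times_sum_cos[OF MN, of x] by (simp only: mult.assoc)
      moreover have "\<bar>c\<bar> \<le> (\<bar>y\<bar> + \<bar>z\<bar>) / 2" if "2 * c = y - z" for c y z :: real
        using abs_triangle_ineq4[of y z] by (simp add: abs_mult flip: that)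
      ultimately show ?thesis unfolding k_def x x_def[symmetric] by blast
    qed
    have "(\<Sum>a=1..L. k (int a) / real a)
        = (\<Sum>a=1..L. s (2 * N + 1) (int a) / real a) / 2 + (\<Sum>a=1..L. s (2 * M - 1) (int a) / real a) / 2"
      unfolding sum_divide_distrib sum.distrib[symmetric]
      by (intro sum.cong refl) (simp add: k_def add_divide_distrib)
    then show "(\<Sum>a=1..L. k (int a) / real a) \<le> 2 / pi * ((\<Sum>a=1..L. 1 / real a) + ln 2 + 2 / real L)"
      using s_sum[of "2 * N + 1"] s_sum[of "2 * M - 1"] by linarith
  qed (use q MN L in auto)
  also note bound
  also note even_bound_le[OF q]
  finally show ?thesis .
qed

lemma odd_char_sum_le:
  assumes odd: "chi (- 1) = - 1" and q: "16 \<le> q" and MN: "M \<le> N"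
  shows "norm (\<Sum>n=M..N. chi n)
    \<le> 1 / (2 * pi) * sqrt (real q) * ln (real q)
      + 1 / pi * sqrt (real q) * (1 + euler_mascheroni + ln (2 * C\<^sub>0 / pi)) + \<psi>\<^sub>2 q"
proof -
  define s where "s = (\<lambda>m a :: int. sin (pi * real_of_int (a * m) / real q))"
  \<comment> \<open>Here the kernel numerator is exactly a product of two sines, whose weighted sum
    has the constant 1 / 2.\<close>
  define k where "k = (\<lambda>a. \<bar>s (M + N) a\<bar> * \<bar>s (N - M + 1) a\<bar>)"
  have s: "s m a = sin (real_of_int m * (pi * real_of_int a / real q))" for m a
    by (simp add: s_def mult_ac)
  have k: "k a = \<bar>s (M + N) a * s (N - M + 1) a\<bar>" for a
    by (simp add: k_def abs_mult)
  obtain K L where L: "0 < L" "2 * L \<le> q" and bound: "(2 * real K + 1) / 2 + 2 / sqrt (real q) *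
      (real q / pi * (1 / 2 * ((\<Sum>a=1..L. 1 / real a) + ln 2 + 2 / real L))
        + pi / (3 * real q) * (real L * (real L + 1) / 2) + (real q)\<^sup>2 / (4 * (2 * real K + 1) * real L))
     \<le> sqrt (real q) + 1 + 2 * sqrt (real q) / pi * (1 / 2 * (ln (real q) / 2 + euler_mascheroni + ln 2))
        + 8 * (1 / 2) / pi + pi * (sqrt (real q) + 1) * (sqrt (real q) + 2) / (3 * sqrt (real q) ^ 3)"
    by (rule obtain_smoothing_parameters[OF q, of "1 / 2"]) (simp, assumption)
  have "norm (\<Sum>n=M..N. chi n) \<le> (2 * real K + 1) / 2 + 2 / sqrt (real q) *
      (real q / pi * (1 / 2 * ((\<Sum>a=1..L. 1 / real a) + ln 2 + 2 / real L))
        + pi / (3 * real q) * (real L * (real L + 1) / 2) + (real q)\<^sup>2 / (4 * (2 * real K + 1) * real L))"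
  proof (rule norm_char_sum_le[where g = sin and u = \<i> and k = k])
    show "sin (v + w) + sin (v - w) = 2 * sin v * cos w" for v w :: real
      by (simp add: sin_add sin_diff)
    show "gauss_sum n = \<i> * (\<Sum>a\<in>{0..<int q}. chi a * of_real (sin (2 * real_of_int n * (pi * real_of_int a / real q))))" for n
      by (rule gauss_sum_odd[OF odd])
    show "0 \<le> k a" for a by (simp add: k_def)
    have "k a \<le> 1 * 1" for a
      unfolding k_def by (intro mult_mono) (auto simp: s_def)
    then show "k a \<le> 1" for a by simp
    show "k (int q - a) = k a" for a
      using q by (simp only: k_def s_def abs_sin_reflect)
    show "\<bar>sin (pi * real_of_int a / real q) * (\<Sum>n=M..N. sin (2 * real_of_int n * (pi * real_of_int a / real q)))\<bar> \<le> k a" for a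
      unfolding sin_times_sum_sin[OF MN] k s by (rule order_refl)
    have k_eq: "k (int a) = \<bar>sin (real a * (pi * real_of_int (M + N) / real q)) * sin (real a * (pi * real_of_int (N - M + 1) / real q))\<bar>" for a
      unfolding k s_def by (simp add: mult_ac)
    show "(\<Sum>a=1..L. k (int a) / real a) \<le> 1 / 2 * ((\<Sum>a=1..L. 1 / real a) + ln 2 + 2 / real L)"
      unfolding k_eq by (rule sum_abs_sin_times_sin_div_le[OF L(1)])
  qed (use q MN L in auto)
  also note bound
  also note odd_bound_le[OF q]
  finally show ?thesis .
qed

section \<open>Small moduli and passage to the maximum\<close>

lemma char_sum_le_trivial:
  assumes "0 \<le> M" "M \<le> N" "N \<le> int q"
  shows "norm (\<Sum>n=M..N. chi n) \<le> real q + 1"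
proof -
  have "norm (\<Sum>n=M..N. chi n) \<le> (\<Sum>n=M..N. 1)"
    by (intro sum_norm_le norm_chi_le_1)
  also have "\<dots> = real_of_int (N - M + 1)" using assms by simp
  \<comment> \<open>The range from 0 to q inclusive has q + 1 terms.\<close>
  also have "\<dots> \<le> real q + 1" using assms by linarith
  finally show ?thesis .
qed

end

lemma even_bound_small:
  assumes "0 < q" "q < 16"
  shows "real q + 1 \<le> 2 / pi\<^sup>2 * sqrt (real q) * ln (real q)
      + 4 / pi\<^sup>2 * sqrt (real q) * (1 + euler_mascheroni + ln C\<^sub>0) + \<psi>\<^sub>1 q"
proof -
  have "0 \<le> ln C\<^sub>0" using C0_ge by simp
  then have "0 \<le> 2 / pi\<^sup>2 * sqrt (real q) * ln (real q)"
    and "0 \<le> 4 / pi\<^sup>2 * sqrt (real q) * (1 + euler_mascheroni + ln C\<^sub>0)"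
    using assms euler_mascheroni_pos by (auto intro!: mult_nonneg_nonneg add_nonneg_nonneg)
  moreover have "real q + 1 \<le> 17" using assms by linarith
  ultimately show ?thesis using psi1_ge(2)[of q] assms by linarith
qed

text \<open>The bound \<open>\<psi>\<^sub>2 >= 10\<close> alone does not reach q + 1, so the linear
  term in r = sqrt q is used as well. Since r <= 3.9, q is at most 3.9 r, and the gap to that term
  stays below 9.\<close>

lemma odd_bound_small:
  assumes "0 < q" "q < 16"
  shows "real q + 1 \<le> 1 / (2 * pi) * sqrt (real q) * ln (real q)
      + 1 / pi * sqrt (real q) * (1 + euler_mascheroni + ln (2 * C\<^sub>0 / pi)) + \<psi>\<^sub>2 q"
proof -
  define r where "r = sqrt (real q)"
  have r: "0 \<le> r" "real q = r\<^sup>2" by (simp_all add: r_def)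
  have "r \<le> sqrt ((39 / 10)\<^sup>2)"
    unfolding r_def using assms by (subst real_sqrt_le_iff) (simp add: power2_eq_square)
  then have r4: "r \<le> 39 / 10" by simp
  have "ln (2 * C\<^sub>0 / pi) = ln 2 + ln (C\<^sub>0 / pi)"
    using C0_ge ln_mult_pos[of 2 "C\<^sub>0 / pi"] by simp
  then have "53 / 10 \<le> 1 + euler_mascheroni + ln (2 * C\<^sub>0 / pi)"
    using ln_C0_div_pi_ge ln2_ge_two_thirds euler_mascheroni_gt_19_over_33 by linarith
  moreover have "100 / 315 \<le> 1 / pi" using pi_approx by (simp add: field_simps)
  ultimately have "(100 / 315 * r) * (53 / 10) \<le> (1 / pi * r) * (1 + euler_mascheroni + ln (2 * C\<^sub>0 / pi))"
    using r by (intro mult_mono mult_right_mono) auto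
  moreover have "0 \<le> 1 / (2 * pi) * r * ln (real q)"
    using assms r by (intro mult_nonneg_nonneg) auto
  moreover have "real q + 1 \<le> 100 / 315 * r * (53 / 10) + 10"
  proof -
    have "r * r \<le> 39 / 10 * r" using r r4 by (intro mult_right_mono) auto
    then show ?thesis using r r4 by (simp add: power2_eq_square)
  qed
  ultimately show ?thesis using psi2_ge(2)[of q] assms unfolding r_def by linarith
qed

lemma max_char_sum_le:
  assumes "0 < q" and "\<And>M N. 0 \<le> M \<Longrightarrow> M < N \<Longrightarrow> N \<le> int q \<Longrightarrow> norm (\<Sum>n=M..N. chi n) \<le> B"
  shows "max_char_sum q chi \<le> B"
proof -
  let ?S = "{norm (\<Sum>n=M..N. chi n) | M N :: int. 0 \<le> M \<and> M < N \<and> N \<le> int q}"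
  have "?S \<subseteq> (\<lambda>(M, N). norm (\<Sum>n=M..N. chi n)) ` ({0..int q} \<times> {0..int q})"
    by force
  then have "finite ?S" by (rule finite_subset) simp
  \<comment> \<open>The pair (0, 1) is admissible since q >= 1, so the maximum is over a nonempty
    set.\<close>
  moreover have "norm (\<Sum>n=0..1. chi n) \<in> ?S"
    using assms(1) by (intro CollectI exI[of _ 0] exI[of _ 1]) simp
  then have "?S \<noteq> {}" by blast
  ultimately show ?thesis
    unfolding max_char_sum_def using assms(2) by (subst Max_le_iff) auto
qed

theorem theorem1:
  fixes q :: nat and chi :: "int \<Rightarrow> complex"
  assumes "q > 0"
    and "primitive_dirichlet_character q chi"
  shows "(chi (- 1) = 1 \<longrightarrow>
            max_char_sum q chi \<le> 2 / pi\<^sup>2 * sqrt (real q) * ln (real q)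
              + 4 / pi\<^sup>2 * sqrt (real q) * (1 + euler_mascheroni + ln C\<^sub>0) + \<psi>\<^sub>1 q)
       \<and> (chi (- 1) = - 1 \<longrightarrow>
            max_char_sum q chi \<le> 1 / (2 * pi) * sqrt (real q) * ln (real q)
              + 1 / pi * sqrt (real q) * (1 + euler_mascheroni + ln (2 * C\<^sub>0 / pi)) + \<psi>\<^sub>2 q)"
proof -
  interpret primitive_char q chi
    using assms(2) by unfold_locales (auto simp: primitive_dirichlet_character_def)
  show ?thesis
  proof (intro conjI impI max_char_sum_le assms(1))
    fix M N assume "0 \<le> M" "M < N" "N \<le> int q"
    then have MN: "0 \<le> M" "M \<le> N" "N \<le> int q" by auto
    show "norm (\<Sum>n=M..N. chi n) \<le> 2 / pi\<^sup>2 * sqrt (real q) * ln (real q)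
        + 4 / pi\<^sup>2 * sqrt (real q) * (1 + euler_mascheroni + ln C\<^sub>0) + \<psi>\<^sub>1 q" if "chi (- 1) = 1"
      \<comment> \<open>The smoothed estimate covers q >= 16; below that the trivial bound is
        enough.\<close>
      using even_char_sum_le[OF that _ MN(2)] char_sum_le_trivial[OF MN] even_bound_small[OF assms(1)]
      by (meson not_le order_trans)
    show "norm (\<Sum>n=M..N. chi n) \<le> 1 / (2 * pi) * sqrt (real q) * ln (real q)
        + 1 / pi * sqrt (real q) * (1 + euler_mascheroni + ln (2 * C\<^sub>0 / pi)) + \<psi>\<^sub>2 q" if "chi (- 1) = - 1"
      using odd_char_sum_le[OF that _ MN(2)] char_sum_le_trivial[OF MN] odd_bound_small[OF assms(1)]
      by (meson not_le order_trans)
  qed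
qed

end
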